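(* Let $X$ be a Banach space. The following are equivalent: (i) $X$ is SWCG with respect to some Banach space. (ii) $X$ is contained in a Banach space $Z$ for which there exists a metrizable topology $\tau_d$ on $B_{Z^*}$ such that: (a) the Mackey topology $\tau$ on $B_{Z^*}$ is finer than $\tau_d$; (b) $\tau_d$ is finer than the topology $\tau_X$ on $B_{Z^*}$ of uniform convergence on weakly compact subsets of $X$.
   Context: Banach spaces are real; $B_Z$ and $B_{Z^*}$ are the closed unit balls of $Z$ and $Z^*$. The inclusion $X\subseteq Z$ of Banach spaces means that $X$ is a closed linear subspace of $Z$ with the induced norm. "Finer" means finer or equal. For $X\subseteq Z$, $X$ is SWCG (strongly weakly compactly generated) with respect to $Z$ if there is a weakly compact (convex and symmetric) subset $K$ of $Z$ such that for each $\varepsilon>0$ and each weakly compact subset $L$ of $X$ there is $n\in\mathbb{N}$ with $L\subseteq nK+\varepsilon B_Z$. The Mackey topology on $Z^*$ is the topology $\tau(Z^*,Z)$ of uniform convergence on weakly compact convex symmetric subsets of $Z$; $\tau$ denotes its restriction to $B_{Z^*}$. *)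

theory Defs
  imports "HOL-Analysis.Analysis"
begin

text \<open>
  Banach spaces over the reals occur below as closed linear subspaces of a type of class
  \<^class>\<open>banach\<close>.  The whole type is such a subspace, so no Banach space is
  excluded; working with subspaces lets a formula quantify over Banach spaces.
\<close>

definition banach_subspace :: "'z::banach set \<Rightarrow> bool" where
  "banach_subspace Z \<longleftrightarrow> subspace Z \<and> closed Z"

text \<open>
  The Banach space of all elements of \<^typ>\<open>'x\<close> is contained in \<open>Z\<close>: it is identified,
  by a linear isometry \<open>j\<close>, with the subspace \<open>range j\<close> of \<open>Z\<close>.  Completeness makes
  \<open>range j\<close> closed.
\<close>

definition contained_via :: "('x::banach \<Rightarrow> 'z::banach) \<Rightarrow> 'z set \<Rightarrow> bool" where
  "contained_via j Z \<longleftrightarrow>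
     banach_subspace Z \<and> linear j \<and> (\<forall>x. norm (j x) = norm x) \<and> range j \<subseteq> Z"

text \<open>
  Functionals on \<open>Z\<close> are elements of \<open>extensional Z\<close>, so that two of them are equal
  as soon as they agree on \<open>Z\<close>.
\<close>

definition dual_space :: "'z::banach set \<Rightarrow> ('z \<Rightarrow> real) set" where
  "dual_space Z = {f \<in> extensional Z.
     (\<forall>x\<in>Z. \<forall>y\<in>Z. f (x + y) = f x + f y) \<and>
     (\<forall>c. \<forall>x\<in>Z. f (c *\<^sub>R x) = c * f x) \<and>
     continuous_on Z f}"

definition dual_norm :: "'z::banach set \<Rightarrow> ('z \<Rightarrow> real) \<Rightarrow> real" where
  "dual_norm Z f = (SUP x\<in>Z \<inter> cball 0 1. \<bar>f x\<bar>)"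

definition dual_ball :: "'z::banach set \<Rightarrow> ('z \<Rightarrow> real) set" where
  "dual_ball Z = {f \<in> dual_space Z. dual_norm Z f \<le> 1}"

definition weak_topology :: "'z::banach set \<Rightarrow> 'z topology" where
  "weak_topology Z =
     topology_generated_by {{x \<in> Z. f x \<in> U} | f U. f \<in> dual_space Z \<and> open U}"

definition weakly_compact :: "'z::banach set \<Rightarrow> 'z set \<Rightarrow> bool" where
  "weakly_compact Z K \<longleftrightarrow> compactin (weak_topology Z) K"

definition symmetric_set :: "'z::real_vector set \<Rightarrow> bool" where
  "symmetric_set K \<longleftrightarrow> (\<forall>x\<in>K. - x \<in> K)"

text \<open>\<open>X\<close> is strongly weakly compactly generated with respect to \<open>Z\<close>.\<close>

definition swcg_wrt :: "'z::banach set \<Rightarrow> 'z set \<Rightarrow> bool" where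
  "swcg_wrt X Z \<longleftrightarrow>
     (\<exists>K. weakly_compact Z K \<and> convex K \<and> symmetric_set K \<and>
       (\<forall>\<epsilon>>0. \<forall>L. weakly_compact X L \<longrightarrow>
         (\<exists>n::nat. L \<subseteq> {real n *\<^sub>R k + \<epsilon> *\<^sub>R b | k b. k \<in> K \<and> b \<in> Z \<inter> cball 0 1})))"

text \<open>
  The topology on a set \<open>D\<close> of functions of uniform convergence on the members of a
  family \<open>\<S>\<close>.
\<close>

definition uniform_conv_topology ::
    "('a \<Rightarrow> real) set \<Rightarrow> 'a set set \<Rightarrow> ('a \<Rightarrow> real) topology" where
  "uniform_conv_topology D \<S> = topology (\<lambda>U. U \<subseteq> D \<and>
     (\<forall>f\<in>U. \<exists>F \<epsilon>. finite F \<and> F \<subseteq> \<S> \<and> \<epsilon> > 0 \<and>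
        {g \<in> D. \<forall>S\<in>F. \<forall>x\<in>S. \<bar>g x - f x\<bar> < \<epsilon>} \<subseteq> U))"

lemma openin_uniform_conv_topology:
  "openin (uniform_conv_topology D \<S>) U \<longleftrightarrow> U \<subseteq> D \<and>
     (\<forall>f\<in>U. \<exists>F \<epsilon>. finite F \<and> F \<subseteq> \<S> \<and> \<epsilon> > 0 \<and>
        {g \<in> D. \<forall>S\<in>F. \<forall>x\<in>S. \<bar>g x - f x\<bar> < \<epsilon>} \<subseteq> U)"
proof -
  define N where "N = (\<lambda>f F \<epsilon>. {g \<in> D. \<forall>S\<in>F. \<forall>x\<in>S. \<bar>g x - f x\<bar> < \<epsilon>})"
  define Q where "Q = (\<lambda>f U. \<exists>F \<epsilon>. finite F \<and> F \<subseteq> \<S> \<and> \<epsilon> > 0 \<and> N f F \<epsilon> \<subseteq> U)"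
  have mono: "Q f V" if "Q f U" "U \<subseteq> V" for f U V
    using that unfolding Q_def by (meson subset_trans)
  have int: "Q f (A \<inter> B)" if A: "Q f A" and B: "Q f B" for f A B
  proof -
    obtain F d where F: "finite F" "F \<subseteq> \<S>" "d > 0" "N f F d \<subseteq> A"
      using A unfolding Q_def by auto
    obtain G e where G: "finite G" "G \<subseteq> \<S>" "e > 0" "N f G e \<subseteq> B"
      using B unfolding Q_def by auto
    have "N f (F \<union> G) (min d e) \<subseteq> N f F d" "N f (F \<union> G) (min d e) \<subseteq> N f G e"
      unfolding N_def by auto
    then have "N f (F \<union> G) (min d e) \<subseteq> A \<inter> B"
      using F(4) G(4) by (meson Int_greatest subset_trans)
    moreover have "finite (F \<union> G)" "F \<union> G \<subseteq> \<S>" "min d e > 0"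
      using F G by auto
    ultimately show ?thesis
      unfolding Q_def by (intro exI[of _ "F \<union> G"] exI[of _ "min d e"] conjI)
  qed
  have "istopology (\<lambda>U. U \<subseteq> D \<and> (\<forall>f\<in>U. Q f U))"
    unfolding istopology_def
  proof (intro conjI allI impI ballI)
    fix \<U> f assume U: "\<forall>A\<in>\<U>. A \<subseteq> D \<and> (\<forall>f\<in>A. Q f A)" and f: "f \<in> \<Union> \<U>"
    from f obtain A where A: "A \<in> \<U>" "f \<in> A" ..
    then have "Q f A" using U by simp
    then show "Q f (\<Union> \<U>)" by (rule mono) (use A in auto)
  qed (auto intro: int)
  from topology_inverse'[OF this] show ?thesis
    unfolding uniform_conv_topology_def Q_def N_def by (rule fun_cong)
qed

lemma topspace_uniform_conv_topology [simp]: "topspace (uniform_conv_topology D \<S>) = D"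
proof (rule subset_antisym)
  show "topspace (uniform_conv_topology D \<S>) \<subseteq> D"
    using openin_topspace openin_uniform_conv_topology by blast
  have "openin (uniform_conv_topology D \<S>) D"
    unfolding openin_uniform_conv_topology
  proof (intro conjI ballI)
    fix f
    show "\<exists>F \<epsilon>. finite F \<and> F \<subseteq> \<S> \<and> \<epsilon> > 0 \<and> {g \<in> D. \<forall>S\<in>F. \<forall>x\<in>S. \<bar>g x - f x\<bar> < \<epsilon>} \<subseteq> D"
      by (intro exI[of _ "{}"] exI[of _ 1]) auto
  qed simp
  then show "D \<subseteq> topspace (uniform_conv_topology D \<S>)"
    by (rule openin_subset)
qed

definition mackey_topology :: "'z::banach set \<Rightarrow> ('z \<Rightarrow> real) topology" where
  "mackey_topology Z = uniform_conv_topology (dual_space Z)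
     {K. weakly_compact Z K \<and> convex K \<and> symmetric_set K}"

definition mackey_ball_topology :: "'z::banach set \<Rightarrow> ('z \<Rightarrow> real) topology" where
  "mackey_ball_topology Z = subtopology (mackey_topology Z) (dual_ball Z)"

text \<open>
  Uniform convergence on the weakly compact subsets of \<open>X\<close>.  On the ball of the dual of
  \<open>Z\<close> this topology need not be Hausdorff.
\<close>

definition sub_ball_topology :: "'z::banach set \<Rightarrow> 'z set \<Rightarrow> ('z \<Rightarrow> real) topology" where
  "sub_ball_topology X Z = uniform_conv_topology (dual_ball Z) {L. weakly_compact X L}"

text \<open>Finer or equal.\<close>

definition finer_topology :: "'a topology \<Rightarrow> 'a topology \<Rightarrow> bool" where
  "finer_topology S T \<longleftrightarrow> topspace S = topspace T \<and> (\<forall>U. openin T U \<longrightarrow> openin S U)"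

end

theory Submission
  imports Defs
begin

text \<open>
  If \<open>K\<close> witnesses that \<open>X\<close> is SWCG with respect to \<open>Z\<close>, uniform convergence on \<open>K\<close> is given
  by a pseudometric on the dual ball, and \<open>L \<subseteq> n K + \<epsilon> B\<close> makes it finer than uniform convergence
  on \<open>L\<close>; passing to the closed span of \<open>K\<close> turns it into a metric.  Conversely, a countable
  neighbourhood base of \<open>0\<close> for \<open>\<tau>\<^sub>d\<close> involves only countably many weakly compact sets.  A suitably
  weighted series absorbs all of them in a single weakly compact \<open>K\<close>, so every weakly compact \<open>L\<close> in \<open>X\<close>
  satisfies a polar inclusion with respect to \<open>K\<close>, and separation turns this into \<open>L \<subseteq> n K + \<epsilon> B\<close>.
\<close>

text \<open>The obstacle in the converse is to gather countably many weakly compact sets into one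
  that is still convex; a closed convex hull would call for Krein's theorem. The sets behind Mackey
  neighbourhoods are already convex and symmetric, and a series formed coordinatewise keeps both
  properties. Its compactness is Tychonoff's theorem: the tails are small uniformly on the product,
  so each functional is continuous there.

  Only neighbourhoods of the zero functional enter the converse. A single \<open>K\<close> may serve
  all of them, each with its own scale \<delta>, because the factor \<open>n\<close> in
  \<open>n K\<close> can be taken as large as \<epsilon> / \<delta>.

  Separation, extension from \<open>Z\<close> to the whole type and norming functionals all come
  from one convex form of Hahn-Banach.

  Both implications keep the embedding \<open>j\<close> and the ambient type: one only shrinks
  \<open>Z\<close>, the other leaves it unchanged.\<close>

section \<open>The Hahn-Banach theorem\<close>

definition sublinear :: "('a::real_vector \<Rightarrow> real) \<Rightarrow> bool" where
  "sublinear p \<longleftrightarrow> (\<forall>x y. p (x + y) \<le> p x + p y) \<and> (\<forall>c\<ge>0. \<forall>x. p (c *\<^sub>R x) = c * p x)"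

lemma sublinear_add: "sublinear p \<Longrightarrow> p (x + y) \<le> p x + p y"
  and sublinear_scale: "sublinear p \<Longrightarrow> 0 \<le> c \<Longrightarrow> p (c *\<^sub>R x) = c * p x"
  by (auto simp: sublinear_def)

lemma sublinear_0: "sublinear p \<Longrightarrow> p 0 = 0"
  using sublinear_scale[of p 0 0] by simp

lemma sublinear_minus: "sublinear p \<Longrightarrow> - p (- x) \<le> p x"
  using sublinear_add[of p x "- x"] sublinear_0[of p] by simp

text \<open>The inequality for \<open>c\<close> and the one for \<open>1/c\<close> combine to
  equality. The value at 0 is squeezed: \<open>c = 2\<close> gives \<open>0 \<le> p 0\<close> and
  \<open>c = 1/2\<close> gives \<open>p 0 \<le> 0\<close>.\<close>

lemma sublinearI:
  assumes add: "\<And>x y. p (x + y) \<le> p x + p y"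
    and scale: "\<And>c x. 0 < c \<Longrightarrow> p (c *\<^sub>R x) \<le> c * p x"
  shows "sublinear p"
proof -
  have "p 0 = 0"
    using scale[of 2 0] scale[of "1/2" 0] by simp
  moreover have "p (c *\<^sub>R x) = c * p x" if "0 < c" for c x
  proof (rule antisym)
    show "p (c *\<^sub>R x) \<le> c * p x" using that by (rule scale)
    have "p ((1/c) *\<^sub>R (c *\<^sub>R x)) \<le> (1/c) * p (c *\<^sub>R x)"
      using that by (intro scale) simp
    then show "c * p x \<le> p (c *\<^sub>R x)"
      using that by (simp add: field_simps)
  qed
  ultimately show ?thesis
    using add unfolding sublinear_def by (metis less_eq_real_def mult_zero_left scaleR_zero_left)
qed

lemma sublinear_norm: "sublinear norm"
  by (auto simp: sublinear_def norm_triangle_ineq)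

text \<open>Subadditivity needs directedness: one \<open>s\<close> has to lie below \<open>q\<close>
  at \<open>x\<close> and below \<open>r\<close> at \<open>y\<close>. The common majorant
  \<open>p\<close> bounds every member from below by \<open>- p (- x)\<close>, so that the infimum
  is a genuine one.\<close>

lemma sublinear_INF:
  assumes ne: "Q \<noteq> {}" and Q: "\<And>q. q \<in> Q \<Longrightarrow> sublinear q \<and> (\<forall>x. q x \<le> p x)"
    and dir: "\<And>q r. q \<in> Q \<Longrightarrow> r \<in> Q \<Longrightarrow> \<exists>s\<in>Q. \<forall>x. s x \<le> q x \<and> s x \<le> r x"
  shows "sublinear (\<lambda>x. INF q\<in>Q. q x)" and "\<And>q. q \<in> Q \<Longrightarrow> (INF q\<in>Q. q x) \<le> q x"
proof -
  have "- p (- x) \<le> q x" if "q \<in> Q" for q x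
    using Q[OF that] sublinear_minus[of q x] by (metis dual_order.trans neg_le_iff_le)
  then have bdd: "bdd_below ((\<lambda>q. q x) ` Q)" for x
    by (intro bdd_belowI2)
  show low: "(INF q\<in>Q. q x) \<le> q x" if "q \<in> Q" for q x
    using that by (intro cINF_lower bdd)
  show "sublinear (\<lambda>x. INF q\<in>Q. q x)"
  proof (rule sublinearI)
    fix x y
    have "(INF q\<in>Q. q (x + y)) \<le> q x + r y" if qr: "q \<in> Q" "r \<in> Q" for q r
    proof -
      obtain s where s: "s \<in> Q" "s x \<le> q x" "s y \<le> r y" using dir[OF qr] by blast
      then show ?thesis
        using low[OF s(1), of "x + y"] sublinear_add[of s x y] Q[OF s(1)] by linarith
    qed
    then have "(INF q\<in>Q. q (x + y)) - r y \<le> (INF q\<in>Q. q x)" if "r \<in> Q" for r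
      using that by (intro cINF_greatest ne) (simp add: algebra_simps)
    then have "(INF q\<in>Q. q (x + y)) - (INF q\<in>Q. q x) \<le> (INF q\<in>Q. q y)"
      by (intro cINF_greatest ne) (simp add: algebra_simps)
    then show "(INF q\<in>Q. q (x + y)) \<le> (INF q\<in>Q. q x) + (INF q\<in>Q. q y)" by simp
  next
    fix c :: real and x assume c: "0 < c"
    have "(INF q\<in>Q. q (c *\<^sub>R x)) / c \<le> q x" if "q \<in> Q" for q
      using low[OF that, of "c *\<^sub>R x"] sublinear_scale[of q c x] Q[OF that] c by (simp add: field_simps)
    then have "(INF q\<in>Q. q (c *\<^sub>R x)) / c \<le> (INF q\<in>Q. q x)"
      by (intro cINF_greatest ne)
    then show "(INF q\<in>Q. q (c *\<^sub>R x)) \<le> c * (INF q\<in>Q. q x)"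
      using c by (simp add: field_simps)
  qed
qed

text \<open>The witness is the infimum of \<open>p (y + t *\<^sub>R c) - t * \<beta>\<close> over
  \<open>t \<ge> 0\<close> and \<open>c \<in> C\<close>, the largest sublinear functional below
  \<open>p\<close> with the required bound on \<open>- C\<close>. The hypothesis on \<beta> keeps
  the infimum finite. Any linear functional below \<open>q\<close> is then at least \<beta> on
  \<open>C\<close>.\<close>

lemma sublinear_lower:
  assumes p: "sublinear p" and C: "convex C" "C \<noteq> {}" and \<beta>: "\<And>c. c \<in> C \<Longrightarrow> \<beta> \<le> p c"
  obtains q where "sublinear q" "\<And>x. q x \<le> p x" "\<And>c. c \<in> C \<Longrightarrow> q (- c) \<le> - \<beta>"
proof -
  define S where "S = (\<lambda>y. {p (y + t *\<^sub>R c) - t * \<beta> | t c. 0 \<le> t \<and> c \<in> C})"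
  define q where "q = (\<lambda>y. Inf (S y))"
  have ne: "S y \<noteq> {}" for y
    using C(2) unfolding S_def by auto
  have "- p (- y) \<le> s" if "s \<in> S y" for y s
  proof -
    obtain t c where s: "s = p (y + t *\<^sub>R c) - t * \<beta>" "0 \<le> t" "c \<in> C"
      using \<open>s \<in> S y\<close> unfolding S_def by auto
    have "t * \<beta> \<le> p (t *\<^sub>R c)"
      using s \<beta> p by (simp add: sublinear_scale mult_left_mono)
    then show ?thesis
      using s sublinear_add[OF p, of "y + t *\<^sub>R c" "- y"] by simp
  qed
  then have low: "q y \<le> s" if "s \<in> S y" for y s
    using that unfolding q_def by (meson bdd_below.I cInf_lower)
  have great: "a \<le> q y" if "\<And>s. s \<in> S y \<Longrightarrow> a \<le> s" for a y
    using that ne unfolding q_def by (intro cInf_greatest)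
  have add: "q (x + y) \<le> s + r" if "s \<in> S x" "r \<in> S y" for x y s r
  proof -
    obtain t c where s: "s = p (x + t *\<^sub>R c) - t * \<beta>" "0 \<le> t" "c \<in> C"
      using \<open>s \<in> S x\<close> unfolding S_def by auto
    obtain u d where r: "r = p (y + u *\<^sub>R d) - u * \<beta>" "0 \<le> u" "d \<in> C"
      using \<open>r \<in> S y\<close> unfolding S_def by auto
    \<comment> \<open>Convexity merges the two directions into one: \<open>e\<close> is their
      average with weights \<open>t\<close> and \<open>u\<close>. If both weights vanish, any point
      of \<open>C\<close> serves.\<close>
    obtain e where e: "e \<in> C" "t *\<^sub>R c + u *\<^sub>R d = (t + u) *\<^sub>R e"
    proof (cases "t + u = 0")
      case True
      then have "t = 0" "u = 0" using s r by auto
      then show ?thesis using that[of c] s by simp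
    next
      case False
      then have pos: "0 < t + u" using s r by auto
      show ?thesis
      proof
        show "(t / (t + u)) *\<^sub>R c + (u / (t + u)) *\<^sub>R d \<in> C"
          using s r pos C by (intro convexD) (auto simp: add_divide_distrib[symmetric])
        show "t *\<^sub>R c + u *\<^sub>R d = (t + u) *\<^sub>R ((t / (t + u)) *\<^sub>R c + (u / (t + u)) *\<^sub>R d)"
          using pos by (simp add: scaleR_add_right)
      qed
    qed
    have "p (x + y + (t + u) *\<^sub>R e) - (t + u) * \<beta> \<in> S (x + y)"
      unfolding S_def using e(1) add_nonneg_nonneg[OF s(2) r(2)] by blast
    then have "q (x + y) \<le> p (x + y + (t + u) *\<^sub>R e) - (t + u) * \<beta>" by (rule low)
    also have "x + y + (t + u) *\<^sub>R e = (x + t *\<^sub>R c) + (y + u *\<^sub>R d)"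
      by (simp add: e(2)[symmetric])
    finally show ?thesis
      using sublinear_add[OF p, of "x + t *\<^sub>R c" "y + u *\<^sub>R d"] s r by (simp add: algebra_simps)
  qed
  show ?thesis
  proof
    show "sublinear q"
    proof (rule sublinearI)
      fix x y
      have "q (x + y) - r \<le> q x" if "r \<in> S y" for r
        using add[OF _ that, of _ x] by (intro great) (simp add: algebra_simps)
      then have "q (x + y) - q x \<le> q y"
        by (intro great) (simp add: algebra_simps)
      then show "q (x + y) \<le> q x + q y" by simp
    next
      fix a :: real and x assume a: "0 < a"
      have "q (a *\<^sub>R x) / a \<le> s" if "s \<in> S x" for s
      proof -
        obtain t c where s: "s = p (x + t *\<^sub>R c) - t * \<beta>" "0 \<le> t" "c \<in> C"
          using \<open>s \<in> S x\<close> unfolding S_def by auto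
        have "p (a *\<^sub>R x + (a * t) *\<^sub>R c) - (a * t) * \<beta> \<in> S (a *\<^sub>R x)"
          unfolding S_def using s(3) mult_nonneg_nonneg[OF less_imp_le[OF a] s(2)] by blast
        moreover have "p (a *\<^sub>R x + (a * t) *\<^sub>R c) = a * p (x + t *\<^sub>R c)"
          using sublinear_scale[OF p, of a "x + t *\<^sub>R c"] a by (simp add: scaleR_add_right)
        ultimately have "a * s \<in> S (a *\<^sub>R x)"
          by (simp add: s(1) algebra_simps)
        then have "q (a *\<^sub>R x) \<le> a * s" by (rule low)
        then show ?thesis using a by (simp add: field_simps)
      qed
      then have "q (a *\<^sub>R x) / a \<le> q x" by (rule great)
      then show "q (a *\<^sub>R x) \<le> a * q x" using a by (simp add: field_simps)
    qed
    fix x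
    obtain c where c: "c \<in> C" using C by auto
    have "p (x + 0 *\<^sub>R c) - 0 * \<beta> \<in> S x"
      using c unfolding S_def by blast
    then show "q x \<le> p x" using low by simp
  next
    fix c assume c: "c \<in> C"
    have "p (- c + 1 *\<^sub>R c) - 1 * \<beta> \<in> S (- c)"
      unfolding S_def using c zero_le_one by blast
    then have "p 0 - \<beta> \<in> S (- c)" by simp
    then show "q (- c) \<le> - \<beta>" using low sublinear_0[OF p] by fastforce
  qed
qed

text \<open>A minimal sublinear functional is linear: lowering it at \<open>- x\<close> to \<open>- m x\<close> must not change it.\<close>

lemma linear_below_sublinear:
  fixes p :: "'a::real_vector \<Rightarrow> real"
  assumes p: "sublinear p"
  obtains F where "linear F" "\<And>x. F x \<le> p x"
proof -
  define A where "A = {q. sublinear q \<and> (\<forall>x. q x \<le> p x)}"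
  \<comment> \<open>The order is reversed, so that a Zorn-maximal element is a pointwise minimal
    sublinear functional.\<close>
  define P where "P = (\<lambda>q r :: 'a \<Rightarrow> real. \<forall>x. r x \<le> q x)"
  have "\<exists>m\<in>A. \<forall>a\<in>A. P m a \<longrightarrow> a = m"
  proof (rule predicate_Zorn)
    show "partial_order_on A (relation_of P A)"
      by (rule partial_order_on_relation_ofI) (auto simp: P_def fun_eq_iff intro: order.trans order.antisym)
    fix Q assume "Q \<in> Chains (relation_of P A)"
    then have QA: "Q \<subseteq> A" and ch: "\<And>q r. q \<in> Q \<Longrightarrow> r \<in> Q \<Longrightarrow> P q r \<or> P r q"
      unfolding Chains_def relation_of_def by auto
    show "\<exists>u\<in>A. \<forall>a\<in>Q. P a u"
    proof (cases "Q = {}")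
      case True
      then show ?thesis using p unfolding A_def by auto
    next
      case False
      have Q: "\<And>q. q \<in> Q \<Longrightarrow> sublinear q \<and> (\<forall>x. q x \<le> p x)"
        using QA unfolding A_def by auto
      have dir: "\<exists>s\<in>Q. \<forall>x. s x \<le> q x \<and> s x \<le> r x" if "q \<in> Q" "r \<in> Q" for q r
        using ch[OF that] that unfolding P_def by blast
      have low: "(INF q\<in>Q. q x) \<le> q x" if "q \<in> Q" for q x
        using sublinear_INF(2)[of Q p q x, OF False Q dir that] .
      have "(INF q\<in>Q. q x) \<le> p x" for x
        using False low Q by (meson dual_order.trans equals0I)
      then have "(\<lambda>x. INF q\<in>Q. q x) \<in> A"
        using sublinear_INF(1)[of Q p, OF False Q dir] unfolding A_def by blast
      then show ?thesis
        using low unfolding P_def by (intro bexI[of _ "\<lambda>x. INF q\<in>Q. q x"]) auto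
    qed
  qed
  then obtain m where mA: "m \<in> A" and max: "\<And>q. q \<in> A \<Longrightarrow> P m q \<Longrightarrow> q = m"
    by blast
  have m: "sublinear m" "\<And>x. m x \<le> p x"
    using mA unfolding A_def by auto
  have min: "q = m" if "sublinear q" "\<And>x. q x \<le> m x" for q
  proof (rule max)
    show "q \<in> A" using that m(2) unfolding A_def by (auto intro: order.trans)
    show "P m q" using that(2) unfolding P_def by blast
  qed
  have neg: "m (- x) = - m x" for x
  proof -
    obtain q where q: "sublinear q" "\<And>y. q y \<le> m y" "q (- x) \<le> - m x"
      using sublinear_lower[OF m(1), of "{x}" "m x"] by auto
    then show ?thesis
      using min[OF q(1,2)] sublinear_minus[OF m(1), of x] by (simp add: order.antisym)
  qed
  have "linear m"
  proof (rule linearI)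
    fix x y
    show "m (x + y) = m x + m y"
      using sublinear_add[OF m(1), of x y] sublinear_add[OF m(1), of "x + y" "- y"] neg[of y] by simp
  next
    fix c :: real and x
    show "m (c *\<^sub>R x) = c *\<^sub>R m x"
    proof (cases "0 \<le> c")
      case True
      then show ?thesis using sublinear_scale[OF m(1)] by simp
    next
      case False
      then show ?thesis using sublinear_scale[OF m(1), of "- c" x] neg[of "c *\<^sub>R x"] by simp
    qed
  qed
  then show ?thesis using m that by blast
qed

text \<open>Lowering \<open>p\<close> first builds the bound on \<open>C\<close> into the sublinear
  functional; every linear functional below the result inherits it.\<close>

lemma hahn_banach_convex:
  assumes "sublinear p" "convex C" "C \<noteq> {}" "\<And>c. c \<in> C \<Longrightarrow> \<beta> \<le> p c"
  obtains F where "linear F" "\<And>x. F x \<le> p x" "\<And>c. c \<in> C \<Longrightarrow> \<beta> \<le> F c"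
proof -
  obtain q where q: "sublinear q" "\<And>x. q x \<le> p x" "\<And>c. c \<in> C \<Longrightarrow> q (- c) \<le> - \<beta>"
    using sublinear_lower[OF assms] by blast
  obtain F where F: "linear F" "\<And>x. F x \<le> q x"
    using linear_below_sublinear[OF q(1)] by blast
  show ?thesis
  proof
    show "F x \<le> p x" for x using F(2)[of x] q(2)[of x] by linarith
    show "\<beta> \<le> F c" if "c \<in> C" for c
      using F(2)[of "- c"] q(3)[OF that] linear_neg[OF F(1), of c] by linarith
  qed (rule F)
qed

text \<open>A linear functional below the norm is bounded, by comparing its values at
  \<open>x\<close> and \<open>- x\<close>. Three kinds of \<open>C\<close> occur later: a slice
  \<open>f = 1\<close> (extension), a singleton (a norming functional) and a translate of a multiple
  of \<open>K\<close> (separation).\<close>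

lemma hahn_banach_norm:
  fixes C :: "'a::real_normed_vector set"
  assumes "convex C" "C \<noteq> {}" "\<And>c. c \<in> C \<Longrightarrow> \<beta> \<le> norm c"
  obtains F :: "'a \<Rightarrow>\<^sub>L real" where "norm F \<le> 1" "\<And>c. c \<in> C \<Longrightarrow> \<beta> \<le> blinfun_apply F c"
proof -
  obtain f where f: "linear f" "\<And>x. f x \<le> norm x" "\<And>c. c \<in> C \<Longrightarrow> \<beta> \<le> f c"
    using hahn_banach_convex[OF sublinear_norm assms] by blast
  have abs: "\<bar>f x\<bar> \<le> norm x" for x
    using f(2)[of x] f(2)[of "- x"] linear_neg[OF f(1), of x] by simp
  have bl: "bounded_linear f"
    using f(1) abs by (intro bounded_linear_intro[where K = 1])
      (auto simp: linear_add linear_scale)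
  show ?thesis
  proof
    show "norm (Blinfun f) \<le> 1"
      using abs bl by (intro norm_blinfun_bound) (auto simp: bounded_linear_Blinfun_apply)
    show "\<beta> \<le> blinfun_apply (Blinfun f) c" if "c \<in> C" for c
      using f(3) that bl by (simp add: bounded_linear_Blinfun_apply)
  qed
qed

section \<open>Duals of subspaces\<close>

lemma restrict_in_dual_space:
  fixes F :: "'z::banach \<Rightarrow>\<^sub>L real"
  assumes "subspace Z"
  shows "restrict (blinfun_apply F) Z \<in> dual_space Z"
proof -
  have "continuous_on Z (restrict (blinfun_apply F) Z) = continuous_on Z (blinfun_apply F)"
    by (rule continuous_on_cong) auto
  then show ?thesis
    using assms unfolding dual_space_def
    by (auto simp: subspace_add subspace_scale blinfun.add_right blinfun.scaleR_right
        intro!: continuous_intros)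
qed

text \<open>
  If \<open>f c0 = 1\<close> and \<open>\<bar>f x\<bar> \<le> N * norm x\<close> on \<open>Z\<close>, the convex set \<open>{c \<in> Z. f c = 1}\<close> stays away from
  the origin.  A functional bounded below on it vanishes on the kernel of \<open>f\<close>, hence is a
  multiple of \<open>f\<close> on \<open>Z\<close>.
\<close>

lemma dual_space_extend:
  fixes Z :: "'z::banach set"
  assumes Z: "subspace Z" and f: "f \<in> dual_space Z"
  obtains F :: "'z \<Rightarrow>\<^sub>L real" where "\<And>x. x \<in> Z \<Longrightarrow> blinfun_apply F x = f x"
proof (cases "\<forall>x\<in>Z. f x = 0")
  case True
  then show ?thesis using that[of 0] by simp
next
  case False
  then obtain z where z: "z \<in> Z" "f z \<noteq> 0" by auto
  have add: "f (x + y) = f x + f y" if "x \<in> Z" "y \<in> Z" for x y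
    using f that unfolding dual_space_def by auto
  have scale: "f (c *\<^sub>R x) = c * f x" if "x \<in> Z" for c x
    using f that unfolding dual_space_def by auto
  have diff: "f (x - y) = f x - f y" if "x \<in> Z" "y \<in> Z" for x y
    using add[of "x - y" y] that Z by (simp add: subspace_diff)
  have f0: "f 0 = 0" using scale[of 0 0] subspace_0[OF Z] by simp
  define C where "C = {c \<in> Z. f c = 1}"
  define c0 where "c0 = (1 / f z) *\<^sub>R z"
  have c0: "c0 \<in> C"
    using z Z scale unfolding C_def c0_def by (simp add: subspace_scale)
  have cv: "convex C"
    unfolding convex_def C_def using Z by (auto simp: add scale subspace_add subspace_scale)
  have "continuous_on Z f" using f unfolding dual_space_def by auto
  \<comment> \<open>Continuity at 0 gives a radius within which \<open>f\<close> cannot reach the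
    value 1, hence a ball that misses the slice \<open>C\<close>.\<close>
  then obtain d where d: "d > 0" "\<And>x. x \<in> Z \<Longrightarrow> norm x < d \<Longrightarrow> \<bar>f x\<bar> < 1"
    unfolding continuous_on_iff using subspace_0[OF Z] f0
    by (metis diff_zero dist_norm real_norm_def zero_less_one)
  have lb: "d \<le> norm c" if "c \<in> C" for c
    using d(2)[of c] that unfolding C_def by force
  obtain G :: "'z \<Rightarrow>\<^sub>L real" where G: "\<And>c. c \<in> C \<Longrightarrow> d \<le> blinfun_apply G c"
    using hahn_banach_norm[OF cv _ lb] c0 by blast
  have ker: "blinfun_apply G x = 0" if x: "x \<in> Z" "f x = 0" for x
  proof (rule ccontr)
    assume nz: "blinfun_apply G x \<noteq> 0"
    \<comment> \<open>Adding a multiple of \<open>x\<close> does not leave the slice; this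
      \<open>t\<close> makes \<open>G\<close> vanish at the new point, although \<open>G\<close> is
      at least \<open>d\<close> there.\<close>
    define t where "t = - blinfun_apply G c0 / blinfun_apply G x"
    have "c0 + t *\<^sub>R x \<in> C"
      using c0 x Z unfolding C_def by (auto simp: add scale subspace_add subspace_scale)
    from G[OF this] show False
      using nz d(1) by (simp add: t_def blinfun.add_right blinfun.diff_right blinfun.scaleR_right)
  qed
  have pos: "blinfun_apply G c0 > 0" using G[OF c0] d(1) by linarith
  show ?thesis
  proof
    fix x assume x: "x \<in> Z"
    have c0Z: "c0 \<in> Z" "f c0 = 1" using c0 unfolding C_def by auto
    have "blinfun_apply G (x - f x *\<^sub>R c0) = 0"
      using x c0Z Z by (intro ker) (auto simp: subspace_diff subspace_scale diff scale)
    then have "blinfun_apply G x = f x * blinfun_apply G c0"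
      by (simp add: blinfun.diff_right blinfun.scaleR_right)
    then show "blinfun_apply ((1 / blinfun_apply G c0) *\<^sub>R G) x = f x"
      using pos by (simp add: blinfun.scaleR_left)
  qed
qed

section \<open>Weakly compact sets\<close>

lemma topspace_weak_topology: "topspace (weak_topology Z) = Z" if "subspace Z"
proof -
  \<comment> \<open>The zero functional with \<open>UNIV\<close> makes \<open>Z\<close> itself a
    generator, and the topspace is the union of the generators.\<close>
  have "{x \<in> Z. restrict (blinfun_apply 0) Z x \<in> UNIV} \<in> {{x \<in> Z. f x \<in> U} | f U. f \<in> dual_space Z \<and> open U}"
    using restrict_in_dual_space[OF that] open_UNIV by blast
  then show ?thesis
    unfolding weak_topology_def topology_generated_by_topspace by auto
qed

lemma continuous_map_into_weak:
  assumes Z: "subspace Z" and h: "\<And>t. t \<in> topspace T \<Longrightarrow> h t \<in> Z"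
    and f: "\<And>f. f \<in> dual_space Z \<Longrightarrow> continuous_map T euclideanreal (\<lambda>t. f (h t))"
  shows "continuous_map T (weak_topology Z) h"
  unfolding weak_topology_def
proof (rule continuous_on_generated_topo)
  show "h ` topspace T \<subseteq> \<Union> {{x \<in> Z. f x \<in> U} |f U. f \<in> dual_space Z \<and> open U}"
    using topspace_weak_topology[OF Z] h
    unfolding weak_topology_def topology_generated_by_topspace by auto
  fix V assume "V \<in> {{x \<in> Z. f x \<in> U} |f U. f \<in> dual_space Z \<and> open U}"
  then obtain g U where g: "V = {x \<in> Z. g x \<in> U}" "g \<in> dual_space Z" "open U" by auto
  have "h -` V \<inter> topspace T = {t \<in> topspace T. g (h t) \<in> U}"
    using g(1) h by auto
  then show "openin T (h -` V \<inter> topspace T)"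
    using f[OF g(2)] g(3) by (simp add: continuous_map_def)
qed

lemma continuous_map_weak_dual:
  assumes Z: "subspace Z" and f: "f \<in> dual_space Z"
  shows "continuous_map (weak_topology Z) euclideanreal f"
proof -
  have "openin (weak_topology Z) {x \<in> Z. f x \<in> U}" if "open U" for U
    unfolding weak_topology_def using f that by (intro topology_generated_by_Basis) blast
  then show ?thesis
    by (simp add: continuous_map_def topspace_weak_topology[OF Z])
qed

lemma weakly_compact_subset: "subspace Z \<Longrightarrow> weakly_compact Z K \<Longrightarrow> K \<subseteq> Z"
  unfolding weakly_compact_def using compactin_subset_topspace topspace_weak_topology by metis

lemma weakly_compact_singleton: "subspace X \<Longrightarrow> x \<in> X \<Longrightarrow> weakly_compact X {x}"
  unfolding weakly_compact_def by (intro finite_imp_compactin) (simp_all add: topspace_weak_topology)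

text \<open>Every functional on \<open>Y\<close> extends beyond \<open>Y\<close>, so the topology
  induced on \<open>Y\<close> by the weak topology of \<open>Z\<close> is finer than the weak
  topology of \<open>Y\<close>, and compactness passes along the identity. This moves a generating
  set into its closed span.\<close>

lemma weakly_compact_subspace:
  fixes Z :: "'z::banach set"
  assumes Z: "subspace Z" and Y: "subspace Y" "Y \<subseteq> Z" and K: "weakly_compact Z K" "K \<subseteq> Y"
  shows "weakly_compact Y K"
proof -
  let ?T = "subtopology (weak_topology Z) Y"
  have "continuous_map ?T (weak_topology Y) id"
  proof (rule continuous_map_into_weak[OF Y(1)])
    show "id t \<in> Y" if "t \<in> topspace ?T" for t using that by simp
    fix f assume "f \<in> dual_space Y"
    then obtain F :: "'z \<Rightarrow>\<^sub>L real" where F: "\<And>x. x \<in> Y \<Longrightarrow> blinfun_apply F x = f x"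
      using dual_space_extend[OF Y(1)] by blast
    have "continuous_map ?T euclideanreal (restrict (blinfun_apply F) Z)"
      by (intro continuous_map_from_subtopology continuous_map_weak_dual restrict_in_dual_space Z)
    then show "continuous_map ?T euclideanreal (\<lambda>t. f (id t))"
      by (rule continuous_map_eq) (use F Y(2) in auto)
  qed
  from image_compactin[OF _ this, of K] show ?thesis
    using K unfolding weakly_compact_def by (simp add: compactin_subtopology)
qed

lemma weakly_compact_bounded_dual:
  assumes "subspace Z" "weakly_compact Z K" "f \<in> dual_space Z"
  shows "bounded (f ` K)"
  using image_compactin[OF _ continuous_map_weak_dual[OF assms(1,3)], of K] assms(2)
  by (simp add: weakly_compact_def compact_imp_bounded)

text \<open>The uniform boundedness principle, for the members of \<open>K\<close> as functionals on the dual.\<close>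

lemma weakly_compact_bounded:
  fixes Z :: "'z::banach set"
  assumes Z: "subspace Z" and K: "weakly_compact Z K"
  shows "bounded K"
proof (rule ccontr)
  assume unb: "\<not> bounded K"
  \<comment> \<open>Baire's theorem is applied in the complete space of bounded functionals on the
    whole type; their restrictions to \<open>Z\<close> supply the pointwise bounds.\<close>
  define E where "E = (\<lambda>n. {F :: 'z \<Rightarrow>\<^sub>L real. \<forall>k\<in>K. \<bar>blinfun_apply F k\<bar> \<le> real n})"
  have "closedin euclidean (E n) \<and> euclidean interior_of (E n) = {}" for n
  proof
    have "closed {F :: 'z \<Rightarrow>\<^sub>L real. \<bar>blinfun_apply F k\<bar> \<le> real n}" for k
      by (intro closed_Collect_le continuous_intros)
    then have "closed (\<Inter>k\<in>K. {F :: 'z \<Rightarrow>\<^sub>L real. \<bar>blinfun_apply F k\<bar> \<le> real n})"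
      by blast
    moreover have "E n = (\<Inter>k\<in>K. {F :: 'z \<Rightarrow>\<^sub>L real. \<bar>blinfun_apply F k\<bar> \<le> real n})"
      unfolding E_def by auto
    ultimately show "closedin euclidean (E n)" by simp
    \<comment> \<open>Moving from \<open>F\<close> by \<open>r/2\<close> along a functional that
      norms \<open>k\<close> stays in the ball. So \<open>(r/2) * norm k\<close> is at most a
      difference of two values bounded by \<open>n\<close>, which bounds all of
      \<open>K\<close>.\<close>
    have False if F: "F \<in> interior (E n)" for F
    proof -
      obtain r where r: "r > 0" "ball F r \<subseteq> E n"
        using F by (meson mem_interior)
      have "norm k \<le> 4 * real n / r" if k: "k \<in> K" for k
      proof -
        obtain G :: "'z \<Rightarrow>\<^sub>L real" where G: "norm G \<le> 1" "norm k \<le> blinfun_apply G k"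
          using hahn_banach_norm[of "{k}" "norm k"] by auto
        have "dist F (F + (r/2) *\<^sub>R G) < r"
          using r(1) G(1) by (simp add: dist_norm field_simps)
        then have "F \<in> E n" "F + (r/2) *\<^sub>R G \<in> E n"
          using r by auto
        then have "\<bar>blinfun_apply F k\<bar> \<le> n" "\<bar>blinfun_apply F k + (r/2) * blinfun_apply G k\<bar> \<le> n"
          using k by (auto simp: E_def blinfun.add_left blinfun.scaleR_left)
        then have "(r/2) * blinfun_apply G k \<le> 2 * n" by linarith
        moreover have "(r/2) * norm k \<le> (r/2) * blinfun_apply G k"
          using r(1) G(2) by simp
        ultimately have "(r/2) * norm k \<le> 2 * n" by linarith
        then show ?thesis using r(1) by (simp add: field_simps)
      qed
      then show False using unb by (auto simp: bounded_iff)
    qed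
    then show "euclidean interior_of (E n) = {}" by auto
  qed
  then have "euclidean interior_of (\<Union> (range E)) = {}"
    by (intro Baire_category_alt) (auto simp: completely_metrizable_space_euclidean)
  moreover have "\<Union> (range E) = UNIV"
  proof -
    have "\<exists>n. F \<in> E n" for F :: "'z \<Rightarrow>\<^sub>L real"
    proof -
      obtain B where "\<forall>k\<in>K. \<bar>restrict (blinfun_apply F) Z k\<bar> \<le> B"
        using weakly_compact_bounded_dual[OF Z K restrict_in_dual_space[OF Z, of F]]
        unfolding bounded_iff by (metis imageI real_norm_def)
      then have "\<forall>k\<in>K. \<bar>blinfun_apply F k\<bar> \<le> B"
        using weakly_compact_subset[OF Z K] by (metis restrict_apply' subsetD)
      then have "F \<in> E (nat \<lceil>B\<rceil>)"
        unfolding E_def by (auto intro: order_trans[OF _ real_nat_ceiling_ge])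
      then show ?thesis ..
    qed
    then show ?thesis by auto
  qed
  ultimately show False by simp
qed

text \<open>
  The set \<open>{\<Sum>i. a i *\<^sub>R k i | k. \<forall>i. k i \<in> C i}\<close>, with the series uniformly convergent, is the
  weakly continuous image of a product of weakly compact sets.
\<close>

lemma weakly_compact_series:
  fixes Z :: "'z::banach set" and C :: "nat \<Rightarrow> 'z set"
  assumes Z: "banach_subspace Z" and C: "\<And>i. weakly_compact Z (C i)"
    and a: "\<And>i x. x \<in> C i \<Longrightarrow> norm (a i *\<^sub>R x) \<le> (1/2) ^ i"
  shows "\<And>k. k \<in> Pi UNIV C \<Longrightarrow> summable (\<lambda>i. a i *\<^sub>R k i)"
    and "weakly_compact Z ((\<lambda>k. \<Sum>i. a i *\<^sub>R k i) ` Pi UNIV C)"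
proof -
  have sZ: "subspace Z" and clZ: "closed Z" using Z unfolding banach_subspace_def by auto
  have CZ: "C i \<subseteq> Z" for i by (rule weakly_compact_subset[OF sZ C])
  have le: "norm (a i *\<^sub>R k i) \<le> (1/2) ^ i" if "k \<in> Pi UNIV C" for k i
    using a that by auto
  have geo: "summable (\<lambda>i. (1/2::real) ^ i)" by (rule summable_geometric) simp
  have sn: "summable (\<lambda>i. norm (a i *\<^sub>R k i))" if "k \<in> Pi UNIV C" for k
    by (rule summable_comparison_test'[OF geo, of 0]) (use le[OF that] in simp)
  show sm: "summable (\<lambda>i. a i *\<^sub>R k i)" if "k \<in> Pi UNIV C" for k
    by (rule summable_norm_cancel[OF sn[OF that]])
  have part: "(\<Sum>i<n. a i *\<^sub>R k i) \<in> Z" if "k \<in> Pi UNIV C" for k n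
    using that CZ by (intro subspace_sum[OF sZ] subspace_scale[OF sZ]) auto
  have inZ: "(\<Sum>i. a i *\<^sub>R k i) \<in> Z" if "k \<in> Pi UNIV C" for k
    using closed_sequentially[OF clZ _ summable_LIMSEQ[OF sm[OF that]]] part[OF that] by blast
  \<comment> \<open>The bound does not depend on \<open>k\<close>; this is the uniformity that makes
    the limit continuous below.\<close>
  have tail: "norm ((\<Sum>i. a i *\<^sub>R k i) - (\<Sum>i<n. a i *\<^sub>R k i)) \<le> 2 * (1/2) ^ n"
    if k: "k \<in> Pi UNIV C" for k n
  proof -
    have g: "(\<lambda>i. (1/2::real) ^ (i + n)) sums (2 * (1/2) ^ n)"
      using sums_mult2[OF geometric_sums[of "1/2::real"], of "(1/2) ^ n"] by (simp add: power_add)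
    have sn': "summable (\<lambda>i. norm (a (i + n) *\<^sub>R k (i + n)))"
      using sn[OF k] by (subst summable_iff_shift)
    have "(\<Sum>i. a i *\<^sub>R k i) - (\<Sum>i<n. a i *\<^sub>R k i) = (\<Sum>i. a (i + n) *\<^sub>R k (i + n))"
      by (rule suminf_minus_initial_segment[OF sm[OF k], symmetric])
    also have "norm \<dots> \<le> (\<Sum>i. norm (a (i + n) *\<^sub>R k (i + n)))"
      by (rule summable_norm[OF sn'])
    also have "\<dots> \<le> (\<Sum>i. (1/2) ^ (i + n))"
      by (rule suminf_le[OF _ sn' sums_summable[OF g]]) (rule le[OF k])
    also have "\<dots> = 2 * (1/2) ^ n" using g by (simp add: sums_iff)
    finally show ?thesis .
  qed
  let ?P = "product_topology (\<lambda>i. subtopology (weak_topology Z) (C i)) UNIV"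
  have top: "topspace ?P = Pi UNIV C"
    using CZ by (auto simp: topspace_weak_topology[OF sZ] PiE_UNIV_domain Pi_iff)
  have "compact_space (subtopology (weak_topology Z) (C i))" for i
    using C[of i] unfolding weakly_compact_def by (simp add: compactin_subspace)
  then have comp: "compactin ?P (Pi UNIV C)"
    unfolding top[symmetric] compact_space_def[symmetric] by (simp add: compact_space_product_topology)
  have "continuous_map ?P (weak_topology Z) (\<lambda>k. \<Sum>i. a i *\<^sub>R k i)"
  proof (rule continuous_map_into_weak[OF sZ])
    show "(\<Sum>i. a i *\<^sub>R k i) \<in> Z" if "k \<in> topspace ?P" for k
      using that inZ unfolding top by simp
    fix f assume f: "f \<in> dual_space Z"
    obtain F :: "'z \<Rightarrow>\<^sub>L real" where F: "\<And>x. x \<in> Z \<Longrightarrow> blinfun_apply F x = f x"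
      using dual_space_extend[OF sZ f] by blast
    \<comment> \<open>The partial sums depend on finitely many coordinates and converge uniformly on
      the product. \<open>Met_TC.mtopology\<close> is the usual topology of the reals, in the form
      that the uniform limit theorem for metric spaces expects.\<close>
    have "continuous_map ?P Met_TC.mtopology (\<lambda>k. f (\<Sum>i. a i *\<^sub>R k i))"
    proof (rule Met_TC.continuous_map_uniform_limit_alt[where F = sequentially
          and f = "\<lambda>n k. \<Sum>i<n. a i * f (k i)"])
      have "continuous_map ?P euclideanreal (\<lambda>k. f (k i))" for i
        using continuous_map_compose[of ?P _ "\<lambda>k. k i" euclideanreal f,
            OF continuous_map_product_projection[of i UNIV]
            continuous_map_from_subtopology[OF continuous_map_weak_dual[OF sZ f], of "C i"]]
        by (simp add: o_def)
      then show "\<forall>\<^sub>F n in sequentially. continuous_map ?P Met_TC.mtopology (\<lambda>k. \<Sum>i<n. a i * f (k i))"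
        by (intro always_eventually allI) (auto intro!: continuous_intros)
      fix \<epsilon> :: real assume \<epsilon>: "0 < \<epsilon>"
      have "(\<lambda>n. norm F * (2 * (1/2) ^ n)) \<longlonglongrightarrow> norm F * (2 * 0)"
        by (intro tendsto_intros LIMSEQ_power_zero) simp
      then have "\<forall>\<^sub>F n in sequentially. norm F * (2 * (1/2) ^ n) < \<epsilon>"
        using \<epsilon> by (intro order_tendstoD) auto
      then show "\<forall>\<^sub>F n in sequentially. \<forall>k\<in>topspace ?P. dist (\<Sum>i<n. a i * f (k i)) (f (\<Sum>i. a i *\<^sub>R k i)) < \<epsilon>"
      proof (rule eventually_mono, intro ballI)
        fix n k assume n: "norm F * (2 * (1/2) ^ n) < \<epsilon>" and "k \<in> topspace ?P"
        then have k: "k \<in> Pi UNIV C" unfolding top by simp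
        have "(\<Sum>i<n. a i * f (k i)) = (\<Sum>i<n. a i * blinfun_apply F (k i))"
        proof (rule sum.cong)
          fix i
          have "k i \<in> Z" using k CZ by auto
          then show "a i * f (k i) = a i * blinfun_apply F (k i)" using F by simp
        qed simp
        also have "\<dots> = blinfun_apply F (\<Sum>i<n. a i *\<^sub>R k i)"
          by (simp add: blinfun.sum_right blinfun.scaleR_right)
        finally have "dist (\<Sum>i<n. a i * f (k i)) (f (\<Sum>i. a i *\<^sub>R k i))
            = norm (blinfun_apply F ((\<Sum>i. a i *\<^sub>R k i) - (\<Sum>i<n. a i *\<^sub>R k i)))"
          using F[OF inZ[OF k]] by (simp add: dist_norm blinfun.diff_right abs_minus_commute)
        also have "\<dots> \<le> norm F * norm ((\<Sum>i. a i *\<^sub>R k i) - (\<Sum>i<n. a i *\<^sub>R k i))"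
          by (rule norm_blinfun)
        also have "\<dots> \<le> norm F * (2 * (1/2) ^ n)"
          using tail[OF k] by (intro mult_left_mono) auto
        finally show "dist (\<Sum>i<n. a i * f (k i)) (f (\<Sum>i. a i *\<^sub>R k i)) < \<epsilon>"
          using n by linarith
      qed
    qed auto
    then show "continuous_map ?P euclideanreal (\<lambda>k. f (\<Sum>i. a i *\<^sub>R k i))" by simp
  qed
  from image_compactin[OF comp this] show "weakly_compact Z ((\<lambda>k. \<Sum>i. a i *\<^sub>R k i) ` Pi UNIV C)"
    unfolding weakly_compact_def .
qed

text \<open>Convex combinations and negatives of such series are formed in each coordinate. Every
  \<open>C i\<close> contains 0, so letting one coordinate vary and setting the others to 0 puts a
  positive multiple of \<open>C i\<close> into \<open>K\<close>.\<close>

lemma weakly_compact_absorbing: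
  fixes Z :: "'z::banach set" and C :: "nat \<Rightarrow> 'z set"
  assumes Z: "banach_subspace Z" and C: "\<And>i. weakly_compact Z (C i)"
    and cv: "\<And>i. convex (C i)" and sy: "\<And>i. symmetric_set (C i)" and ne: "\<And>i. C i \<noteq> {}"
  obtains K where "weakly_compact Z K" "convex K" "symmetric_set K" "K \<noteq> {}"
    "\<And>i. \<exists>m>0. \<forall>x\<in>C i. \<exists>k\<in>K. x = m *\<^sub>R k"
proof -
  have sZ: "subspace Z" using Z unfolding banach_subspace_def by auto
  have zero: "0 \<in> C i" for i
  proof -
    obtain x where x: "x \<in> C i" using ne by blast
    then have "- x \<in> C i" using sy unfolding symmetric_set_def by blast
    then have "(1/2) *\<^sub>R x + (1/2) *\<^sub>R (- x) \<in> C i" using x by (intro convexD[OF cv]) auto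
    then show ?thesis by simp
  qed
  have "\<forall>i. \<exists>B>0. \<forall>x\<in>C i. norm x \<le> B"
    using weakly_compact_bounded[OF sZ C] by (simp add: bounded_pos)
  then obtain B where B: "\<And>i. B i > 0" "\<And>i x. x \<in> C i \<Longrightarrow> norm x \<le> B i"
    by metis
  \<comment> \<open>Dividing by the bound \<open>B i\<close> of \<open>C i\<close> makes the
    \<open>i\<close>-th summand at most \<open>(1/2) ^ i\<close>.\<close>
  define a where "a = (\<lambda>i. (1/2) ^ i / B i)"
  have apos: "a i > 0" for i unfolding a_def using B by simp
  have ale: "norm (a i *\<^sub>R x) \<le> (1/2) ^ i" if "x \<in> C i" for i x
    using B(1)[of i] B(2)[OF that] by (simp add: a_def field_simps)
  define K where "K = (\<lambda>k. \<Sum>i. a i *\<^sub>R k i) ` Pi UNIV C"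
  have sm: "summable (\<lambda>i. a i *\<^sub>R k i)" if "k \<in> Pi UNIV C" for k
    using Z C ale that by (rule weakly_compact_series(1))
  show ?thesis
  proof
    show "weakly_compact Z K"
      unfolding K_def using Z C ale by (rule weakly_compact_series(2))
    show "convex K"
    proof (rule convexI)
      fix x y u v assume "x \<in> K" "y \<in> K" and uv: "0 \<le> u" "0 \<le> v" "u + v = (1::real)"
      then obtain k l where k: "k \<in> Pi UNIV C" "x = (\<Sum>i. a i *\<^sub>R k i)"
        and l: "l \<in> Pi UNIV C" "y = (\<Sum>i. a i *\<^sub>R l i)"
        unfolding K_def by auto
      have "u *\<^sub>R x + v *\<^sub>R y = (\<Sum>i. u *\<^sub>R a i *\<^sub>R k i + v *\<^sub>R a i *\<^sub>R l i)"
        unfolding k(2) l(2)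
        by (intro sums_unique sums_add sums_scaleR_right summable_sums sm k(1) l(1))
      also have "\<dots> = (\<Sum>i. a i *\<^sub>R (u *\<^sub>R k i + v *\<^sub>R l i))"
        by (simp add: algebra_simps)
      finally show "u *\<^sub>R x + v *\<^sub>R y \<in> K"
        unfolding K_def using k(1) l(1) uv
        by (intro image_eqI[of _ _ "\<lambda>i. u *\<^sub>R k i + v *\<^sub>R l i"]) (auto intro!: convexD[OF cv])
    qed
    show "symmetric_set K"
      unfolding symmetric_set_def
    proof
      fix x assume "x \<in> K"
      then obtain k where k: "k \<in> Pi UNIV C" "x = (\<Sum>i. a i *\<^sub>R k i)"
        unfolding K_def by auto
      have "- x = (\<Sum>i. a i *\<^sub>R (- k i))"
        unfolding k(2) using suminf_minus[OF sm[OF k(1)]] by simp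
      then show "- x \<in> K"
        unfolding K_def using k(1) sy
        by (intro image_eqI[of _ _ "\<lambda>i. - k i"]) (auto simp: symmetric_set_def)
    qed
    show "K \<noteq> {}"
      unfolding K_def using zero by (auto simp: Pi_eq_empty intro: exI[of _ "\<lambda>i. 0"])
    fix i
    show "\<exists>m>0. \<forall>x\<in>C i. \<exists>k\<in>K. x = m *\<^sub>R k"
    proof (intro exI[of _ "1 / a i"] conjI ballI)
      show "0 < 1 / a i" using apos by simp
      fix x assume x: "x \<in> C i"
      have "(\<Sum>j. a j *\<^sub>R (if j = i then x else 0)) = (\<Sum>j\<in>{i}. a j *\<^sub>R (if j = i then x else 0))"
        by (rule suminf_finite) auto
      then have "a i *\<^sub>R x \<in> K"
        unfolding K_def using x zero
        by (intro image_eqI[of _ _ "\<lambda>j. if j = i then x else 0"]) auto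
      then show "\<exists>k\<in>K. x = (1 / a i) *\<^sub>R k"
        using apos[of i] by (intro bexI[of _ "a i *\<^sub>R x"]) auto
    qed
  qed
qed

section \<open>Dual balls\<close>

lemma dual_ball_bound:
  fixes Z :: "'z::banach set"
  assumes Z: "subspace Z" and f: "f \<in> dual_ball Z" and x: "x \<in> Z"
  shows "\<bar>f x\<bar> \<le> norm x"
proof (cases "x = 0")
  case True
  have "f (0 *\<^sub>R x) = 0 * f x"
    using f x unfolding dual_ball_def dual_space_def by blast
  then show ?thesis using True by simp
next
  case False
  have fd: "f \<in> dual_space Z" and le1: "dual_norm Z f \<le> 1"
    using f unfolding dual_ball_def by auto
  obtain F :: "'z \<Rightarrow>\<^sub>L real" where F: "\<And>y. y \<in> Z \<Longrightarrow> blinfun_apply F y = f y"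
    using dual_space_extend[OF Z fd] by blast
  \<comment> \<open>The supremum of an unbounded set of reals would carry no information, so
    boundedness has to come first; the bounded extension \<open>F\<close> provides it.\<close>
  have bdd: "bdd_above ((\<lambda>y. \<bar>f y\<bar>) ` (Z \<inter> cball 0 1))"
  proof (rule bdd_aboveI2)
    fix y assume y: "y \<in> Z \<inter> cball 0 1"
    then have "\<bar>f y\<bar> \<le> norm F * norm y"
      using norm_blinfun[of F y] F[of y] by simp
    also have "\<dots> \<le> norm F"
      using y mult_left_le[of "norm y" "norm F"] by (simp add: dist_norm)
    finally show "\<bar>f y\<bar> \<le> norm F" .
  qed
  define y where "y = (1 / norm x) *\<^sub>R x"
  have y: "y \<in> Z \<inter> cball 0 1"
    using x Z False unfolding y_def by (simp add: subspace_scale)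
  have "\<bar>f y\<bar> \<le> 1"
    using cSUP_upper[OF y bdd] le1 unfolding dual_norm_def by linarith
  moreover have "f y = (1 / norm x) * f x"
    using fd x unfolding dual_space_def y_def by blast
  ultimately show ?thesis
    using False by (simp add: field_simps abs_mult)
qed

lemma restrict_in_dual_ball:
  fixes F :: "'z::banach \<Rightarrow>\<^sub>L real"
  assumes Z: "subspace Z" and F: "norm F \<le> 1"
  shows "restrict (blinfun_apply F) Z \<in> dual_ball Z"
proof -
  have "dual_norm Z (restrict (blinfun_apply F) Z) \<le> 1"
    unfolding dual_norm_def
  proof (rule cSUP_least)
    show "Z \<inter> cball 0 1 \<noteq> {}" using subspace_0[OF Z] by auto
    fix y assume y: "y \<in> Z \<inter> cball 0 1"
    have "norm (blinfun_apply F y) \<le> norm F * norm y" by (rule norm_blinfun)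
    also have "\<dots> \<le> 1 * 1" using y F by (intro mult_mono) auto
    finally show "\<bar>restrict (blinfun_apply F) Z y\<bar> \<le> 1" using y by simp
  qed
  then show ?thesis
    unfolding dual_ball_def using restrict_in_dual_space[OF Z] by blast
qed

text \<open>A strict pointwise bound on an infinite \<open>S\<close> need not define an open set.
  The margin between \<eta> and \<epsilon> does: half of it is left for perturbing
  \<open>f\<close>.\<close>

lemma openin_uniform_conv_ball:
  assumes "S \<in> \<S>"
  shows "openin (uniform_conv_topology D \<S>) {f \<in> D. \<exists>\<eta><\<epsilon>. \<forall>x\<in>S. \<bar>f x - g x\<bar> \<le> \<eta>}"
  unfolding openin_uniform_conv_topology
proof (intro conjI ballI)
  fix f assume "f \<in> {f \<in> D. \<exists>\<eta><\<epsilon>. \<forall>x\<in>S. \<bar>f x - g x\<bar> \<le> \<eta>}"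
  then obtain \<eta> where f: "f \<in> D" and \<eta>: "\<eta> < \<epsilon>" "\<And>x. x \<in> S \<Longrightarrow> \<bar>f x - g x\<bar> \<le> \<eta>" by auto
  have "{h \<in> D. \<forall>S\<in>{S}. \<forall>x\<in>S. \<bar>h x - f x\<bar> < (\<epsilon> - \<eta>) / 2}
      \<subseteq> {f \<in> D. \<exists>\<eta><\<epsilon>. \<forall>x\<in>S. \<bar>f x - g x\<bar> \<le> \<eta>}"
  proof
    fix h assume h: "h \<in> {h \<in> D. \<forall>S\<in>{S}. \<forall>x\<in>S. \<bar>h x - f x\<bar> < (\<epsilon> - \<eta>) / 2}"
    have "\<bar>h x - g x\<bar> \<le> (\<epsilon> + \<eta>) / 2" if "x \<in> S" for x
    proof -
      have "\<bar>h x - f x\<bar> < (\<epsilon> - \<eta>) / 2" using h that by auto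
      then show ?thesis using \<eta>(2)[OF that] by (simp add: field_simps abs_if split: if_splits)
    qed
    moreover have "(\<epsilon> + \<eta>) / 2 < \<epsilon>" using \<eta>(1) by simp
    ultimately show "h \<in> {f \<in> D. \<exists>\<eta><\<epsilon>. \<forall>x\<in>S. \<bar>f x - g x\<bar> \<le> \<eta>}"
      using h by blast
  qed
  then show "\<exists>F \<delta>. finite F \<and> F \<subseteq> \<S> \<and> 0 < \<delta> \<and>
      {h \<in> D. \<forall>S\<in>F. \<forall>x\<in>S. \<bar>h x - f x\<bar> < \<delta>} \<subseteq> {f \<in> D. \<exists>\<eta><\<epsilon>. \<forall>x\<in>S. \<bar>f x - g x\<bar> \<le> \<eta>}"
    using \<eta>(1) assms by (intro exI[of _ "{S}"] exI[of _ "(\<epsilon> - \<eta>) / 2"] conjI) auto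
qed auto

section \<open>From strong weak compact generation to metrizability\<close>

lemma absorbing_imp_metrizable:
  fixes Y :: "'z::banach set"
  assumes Y: "banach_subspace Y"
    and K: "weakly_compact Y K" "convex K" "symmetric_set K" "K \<noteq> {}"
    and dense: "Y \<subseteq> closure (span K)"
    and absorb: "\<And>\<epsilon> L. \<epsilon> > 0 \<Longrightarrow> weakly_compact X L \<Longrightarrow>
        \<exists>n::nat. L \<subseteq> {real n *\<^sub>R k + \<epsilon> *\<^sub>R b | k b. k \<in> K \<and> b \<in> Y \<inter> cball 0 1}"
  shows "\<exists>\<tau>\<^sub>d. topspace \<tau>\<^sub>d = dual_ball Y \<and> metrizable_space \<tau>\<^sub>d \<and>
      finer_topology (mackey_ball_topology Y) \<tau>\<^sub>d \<and> finer_topology \<tau>\<^sub>d (sub_ball_topology X Y)"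
proof -
  have sY: "subspace Y" using Y unfolding banach_subspace_def by auto
  have KY: "K \<subseteq> Y" by (rule weakly_compact_subset[OF sY K(1)])
  have ball_dual: "f \<in> dual_space Y" if "f \<in> dual_ball Y" for f
    using that unfolding dual_ball_def by auto
  \<comment> \<open>The outer absolute value makes \<open>d\<close> nonnegative also where the supremum is taken over an
    unbounded set; \<^locale>\<open>Metric_space\<close> asks for this everywhere.\<close>
  define d where "d = (\<lambda>f g :: 'z \<Rightarrow> real. \<bar>SUP k\<in>K. \<bar>f k - g k\<bar>\<bar>)"
  have bdd: "bdd_above ((\<lambda>k. \<bar>f k - g k\<bar>) ` K)" if fg: "f \<in> dual_ball Y" "g \<in> dual_ball Y" for f g
  proof -
    obtain A B where "\<forall>k\<in>K. \<bar>f k\<bar> \<le> A" "\<forall>k\<in>K. \<bar>g k\<bar> \<le> B"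
      using weakly_compact_bounded_dual[OF sY K(1) ball_dual[OF fg(1)]]
        weakly_compact_bounded_dual[OF sY K(1) ball_dual[OF fg(2)]]
      unfolding bounded_iff by auto
    then have "\<bar>f k - g k\<bar> \<le> A + B" if "k \<in> K" for k
      using that abs_triangle_ineq4[of "f k" "g k"] by fastforce
    then show ?thesis by (rule bdd_aboveI2)
  qed
  have d_upper: "\<bar>f k - g k\<bar> \<le> d f g" if "f \<in> dual_ball Y" "g \<in> dual_ball Y" "k \<in> K" for f g k
    using cSUP_upper[OF that(3) bdd[OF that(1,2)]] unfolding d_def by linarith
  have d_least: "d f g \<le> c" if "f \<in> dual_ball Y" "g \<in> dual_ball Y" "\<And>k. k \<in> K \<Longrightarrow> \<bar>f k - g k\<bar> \<le> c" for f g c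
  proof -
    obtain k where k: "k \<in> K" using K(4) by auto
    have "0 \<le> (SUP k\<in>K. \<bar>f k - g k\<bar>)"
      using cSUP_upper[OF k bdd[OF that(1,2)]] abs_ge_zero[of "f k - g k"] by linarith
    moreover have "(SUP k\<in>K. \<bar>f k - g k\<bar>) \<le> c"
      using K(4) that(3) by (rule cSUP_least)
    ultimately show ?thesis unfolding d_def by simp
  qed
  have d_eq: "f = g" if fg: "f \<in> dual_ball Y" "g \<in> dual_ball Y" and 0: "d f g = 0" for f g
  proof -
    obtain F :: "'z \<Rightarrow>\<^sub>L real" where F: "\<And>x. x \<in> Y \<Longrightarrow> blinfun_apply F x = f x"
      using dual_space_extend[OF sY ball_dual[OF fg(1)]] by blast
    obtain G :: "'z \<Rightarrow>\<^sub>L real" where G: "\<And>x. x \<in> Y \<Longrightarrow> blinfun_apply G x = g x"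
      using dual_space_extend[OF sY ball_dual[OF fg(2)]] by blast
    let ?E = "{x. blinfun_apply F x = blinfun_apply G x}"
    have "K \<subseteq> ?E"
    proof
      fix k assume k: "k \<in> K"
      then show "k \<in> ?E"
        using d_upper[OF fg k] 0 F[of k] G[of k] KY by auto
    qed
    moreover have "subspace ?E"
      unfolding subspace_def by (auto simp: blinfun.add_right blinfun.scaleR_right)
    ultimately have "span K \<subseteq> ?E" by (rule span_minimal)
    moreover have "closed ?E" by (intro closed_Collect_eq continuous_intros)
    ultimately have "Y \<subseteq> ?E" using dense closure_minimal by blast
    then have "f x = g x" if "x \<in> Y" for x
      using that F[OF that] G[OF that] by auto
    moreover have "f \<in> extensional Y" "g \<in> extensional Y"
      using fg ball_dual unfolding dual_space_def by auto
    ultimately show ?thesis by (intro extensionalityI) auto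
  qed
  interpret M: Metric_space "dual_ball Y" d
  proof
    show "0 \<le> d f g" for f g by (simp add: d_def)
    show "d f g = d g f" for f g by (simp add: d_def abs_minus_commute)
    show "d f g = 0 \<longleftrightarrow> f = g" if "f \<in> dual_ball Y" "g \<in> dual_ball Y" for f g
    proof
      show "f = g" if "d f g = 0" using \<open>f \<in> dual_ball Y\<close> \<open>g \<in> dual_ball Y\<close> that by (rule d_eq)
      have "d f f \<le> 0" using that(1) that(1) by (rule d_least) simp
      then show "d f g = 0" if "f = g" using that unfolding d_def by simp
    qed
    show "d f h \<le> d f g + d g h" if fgh: "f \<in> dual_ball Y" "g \<in> dual_ball Y" "h \<in> dual_ball Y" for f g h
    proof (rule d_least[OF fgh(1,3)])
      fix k assume "k \<in> K"
      then show "\<bar>f k - h k\<bar> \<le> d f g + d g h"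
        using d_upper[OF fgh(1,2)] d_upper[OF fgh(2,3)] by fastforce
    qed
  qed
  have "openin (mackey_ball_topology Y) U" if U: "openin M.mtopology U" for U
  proof -
    \<comment> \<open>The Mackey topology lives on the whole dual, where \<open>d\<close> is no
      metric. The sets \<open>N g r\<close> are open there and meet the dual ball inside the metric
      balls, so that \<open>U\<close> becomes the trace of an open set.\<close>
    define N where "N = (\<lambda>g r. {f \<in> dual_space Y. \<exists>\<eta><r. \<forall>x\<in>K. \<bar>f x - g x\<bar> \<le> \<eta>})"
    define T where "T = \<Union> {N g r | g r. g \<in> U \<and> M.mball g r \<subseteq> U \<and> 0 < r}"
    have "openin (mackey_topology Y) (N g r)" for g r
      unfolding mackey_topology_def N_def
      by (rule openin_uniform_conv_ball) (use K in auto)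
    then have T: "openin (mackey_topology Y) T"
      unfolding T_def by (intro openin_Union) auto
    have UB: "U \<subseteq> dual_ball Y" using U by (simp add: M.openin_mtopology)
    have "U = T \<inter> dual_ball Y"
    proof (intro subset_antisym subsetI IntI)
      fix f assume f: "f \<in> U"
      then show fB: "f \<in> dual_ball Y" using UB by auto
      obtain r where r: "r > 0" "M.mball f r \<subseteq> U"
        using U f unfolding M.openin_mtopology by blast
      have "f \<in> N f r"
        using ball_dual[OF fB] r(1) unfolding N_def by auto
      then show "f \<in> T" unfolding T_def using f r by blast
    next
      fix f assume "f \<in> T \<inter> dual_ball Y"
      then obtain g r where fB: "f \<in> dual_ball Y" and g: "g \<in> U" "M.mball g r \<subseteq> U" and "f \<in> N g r"
        unfolding T_def by auto
      then obtain \<eta> where \<eta>: "\<eta> < r" "\<And>x. x \<in> K \<Longrightarrow> \<bar>f x - g x\<bar> \<le> \<eta>"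
        unfolding N_def by auto
      have gB: "g \<in> dual_ball Y" using g UB by auto
      have "d g f \<le> \<eta>"
        by (rule d_least[OF gB fB]) (use \<eta>(2) in \<open>simp add: abs_minus_commute\<close>)
      then show "f \<in> U" using g \<eta>(1) fB gB by auto
    qed
    then show ?thesis
      unfolding mackey_ball_topology_def openin_subtopology using T by blast
  qed
  moreover have "topspace (mackey_ball_topology Y) = dual_ball Y"
    using ball_dual unfolding mackey_ball_topology_def mackey_topology_def by auto
  ultimately have fin1: "finer_topology (mackey_ball_topology Y) M.mtopology"
    unfolding finer_topology_def by simp
  have "openin M.mtopology U" if U: "openin (sub_ball_topology X Y) U" for U
    unfolding M.openin_mtopology
  proof (intro conjI allI impI)
    show "U \<subseteq> dual_ball Y"
      using U unfolding sub_ball_topology_def openin_uniform_conv_topology by blast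
    fix f assume f: "f \<in> U"
    then have fB: "f \<in> dual_ball Y" using \<open>U \<subseteq> dual_ball Y\<close> by auto
    obtain F \<epsilon> where F: "finite F" "F \<subseteq> {L. weakly_compact X L}" "\<epsilon> > 0"
      "{g \<in> dual_ball Y. \<forall>S\<in>F. \<forall>x\<in>S. \<bar>g x - f x\<bar> < \<epsilon>} \<subseteq> U"
      using U f unfolding sub_ball_topology_def openin_uniform_conv_topology by meson
    \<comment> \<open>Two functionals in the dual ball differ by at most 2 on the unit ball, so the
      error term costs \<epsilon>/2. The radius \<open>\<epsilon> / (4 * N)\<close> keeps the part
      from \<open>K\<close> within \<epsilon>/4, which leaves room for strictness.\<close>
    have "\<forall>L\<in>F. \<exists>n::nat. L \<subseteq> {real n *\<^sub>R k + (\<epsilon>/4) *\<^sub>R b | k b. k \<in> K \<and> b \<in> Y \<inter> cball 0 1}"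
      using absorb[of "\<epsilon>/4"] F(2,3) by auto
    from bchoice[OF this] obtain n :: "'z set \<Rightarrow> nat"
      where n: "\<And>L. L \<in> F \<Longrightarrow> L \<subseteq> {real (n L) *\<^sub>R k + (\<epsilon>/4) *\<^sub>R b | k b. k \<in> K \<and> b \<in> Y \<inter> cball 0 1}"
      by blast
    \<comment> \<open>The sum dominates every \<open>n L\<close> at once, and the added 1 keeps the
      radius well defined when the sum is 0.\<close>
    define N where "N = real (sum n F) + 1"
    have N: "N > 0" unfolding N_def by (simp del: of_nat_sum)
    have nN: "real (n L) \<le> N" if "L \<in> F" for L
    proof -
      have "n L \<le> sum n F" using that F(1) by (intro member_le_sum) auto
      then have "real (n L) \<le> real (sum n F)" by (rule of_nat_mono)
      then show ?thesis unfolding N_def by linarith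
    qed
    have "M.mball f (\<epsilon> / (4 * N)) \<subseteq> {g \<in> dual_ball Y. \<forall>S\<in>F. \<forall>x\<in>S. \<bar>g x - f x\<bar> < \<epsilon>}"
    proof (intro subsetI CollectI conjI ballI)
      fix g assume g: "g \<in> M.mball f (\<epsilon> / (4 * N))"
      then show gB: "g \<in> dual_ball Y" by auto
      fix L x assume L: "L \<in> F" "x \<in> L"
      then obtain k b where x: "x = real (n L) *\<^sub>R k + (\<epsilon>/4) *\<^sub>R b" and k: "k \<in> K" and b: "b \<in> Y" "norm b \<le> 1"
        using n[OF L(1)] by auto
      have lin: "h x = real (n L) * h k + (\<epsilon>/4) * h b" if "h \<in> dual_ball Y" for h
        using ball_dual[OF that] k b KY sY unfolding x dual_space_def by (auto simp: subspace_scale subsetD)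
      have "\<bar>g k - f k\<bar> \<le> \<epsilon> / (4 * N)"
        using d_upper[OF fB gB k] g by (auto simp: abs_minus_commute)
      then have "real (n L) * \<bar>g k - f k\<bar> \<le> N * (\<epsilon> / (4 * N))"
        using N nN L by (intro mult_mono) auto
      then have 1: "real (n L) * \<bar>g k - f k\<bar> \<le> \<epsilon>/4"
        using N by simp
      have "\<bar>g b - f b\<bar> \<le> 2"
        using dual_ball_bound[OF sY gB b(1)] dual_ball_bound[OF sY fB b(1)] b(2) by linarith
      then have 2: "(\<epsilon>/4) * \<bar>g b - f b\<bar> \<le> \<epsilon>/2"
        using F(3) by simp
      have "\<bar>g x - f x\<bar> = \<bar>real (n L) * (g k - f k) + (\<epsilon>/4) * (g b - f b)\<bar>"
        unfolding lin[OF gB] lin[OF fB] by (simp add: algebra_simps diff_divide_distrib)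
      also have "\<dots> \<le> real (n L) * \<bar>g k - f k\<bar> + (\<epsilon>/4) * \<bar>g b - f b\<bar>"
        using F(3) by (intro order.trans[OF abs_triangle_ineq]) (simp add: abs_mult)
      finally show "\<bar>g x - f x\<bar> < \<epsilon>" using 1 2 F(3) by linarith
    qed
    then show "\<exists>r>0. M.mball f r \<subseteq> U"
      using F(3,4) N by (intro exI[of _ "\<epsilon> / (4 * N)"]) auto
  qed
  then have "finer_topology M.mtopology (sub_ball_topology X Y)"
    unfolding finer_topology_def sub_ball_topology_def by simp
  then show ?thesis
    using fin1 M.metrizable_space_mtopology by (intro exI[of _ M.mtopology]) auto
qed

lemma subspace_closure:
  fixes S :: "'a::real_normed_vector set"
  assumes S: "subspace S"
  shows "subspace (closure S)"
proof (rule subspaceI)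
  show "0 \<in> closure S" using subspace_0[OF S] closure_subset by blast
  fix x assume "x \<in> closure S"
  then obtain u where u: "\<And>n. u n \<in> S" "u \<longlonglongrightarrow> x" unfolding closure_sequential by auto
  show "c *\<^sub>R x \<in> closure S" for c
    using subspace_scale[OF S u(1)] tendsto_scaleR[OF tendsto_const u(2)]
    unfolding closure_sequential by (intro exI[of _ "\<lambda>n. c *\<^sub>R u n"]) auto
  fix y assume "y \<in> closure S"
  then obtain v where v: "\<And>n. v n \<in> S" "v \<longlonglongrightarrow> y" unfolding closure_sequential by auto
  show "x + y \<in> closure S"
    using subspace_add[OF S u(1) v(1)] tendsto_add[OF u(2) v(2)]
    unfolding closure_sequential by (intro exI[of _ "\<lambda>n. u n + v n"]) auto
qed

text \<open>
  Uniform convergence on \<open>K\<close> is Hausdorff only if \<open>K\<close> generates the space, so \<open>Z\<close> is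
  replaced by the closed span of \<open>K\<close>, which still contains \<open>X\<close>.
\<close>

lemma swcg_imp_metrizable:
  fixes Z :: "'z::banach set"
  assumes Z: "banach_subspace Z" and X: "subspace X" "X \<subseteq> Z" and sw: "swcg_wrt X Z"
  obtains Y \<tau>\<^sub>d where "banach_subspace Y" "X \<subseteq> Y"
    "topspace \<tau>\<^sub>d = dual_ball Y" "metrizable_space \<tau>\<^sub>d"
    "finer_topology (mackey_ball_topology Y) \<tau>\<^sub>d" "finer_topology \<tau>\<^sub>d (sub_ball_topology X Y)"
proof -
  have sZ: "subspace Z" and clZ: "closed Z" using Z unfolding banach_subspace_def by auto
  obtain K where K: "weakly_compact Z K" "convex K" "symmetric_set K"
    and absorb: "\<And>\<epsilon> L. \<epsilon> > 0 \<Longrightarrow> weakly_compact X L \<Longrightarrow>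
        \<exists>n::nat. L \<subseteq> {real n *\<^sub>R k + \<epsilon> *\<^sub>R b | k b. k \<in> K \<and> b \<in> Z \<inter> cball 0 1}"
    using sw unfolding swcg_wrt_def by blast
  define Y where "Y = closure (span K)"
  have Y: "banach_subspace Y"
    unfolding banach_subspace_def Y_def by (simp add: subspace_closure)
  then have sY: "subspace Y" unfolding banach_subspace_def by auto
  have KY: "K \<subseteq> Y" unfolding Y_def using span_superset closure_subset by blast
  have "span K \<subseteq> Z" using weakly_compact_subset[OF sZ K(1)] sZ by (rule span_minimal)
  then have YZ: "Y \<subseteq> Z" unfolding Y_def using clZ by (rule closure_minimal)
  have Kne: "K \<noteq> {}"
    using absorb[OF zero_less_one weakly_compact_singleton[OF X(1) subspace_0[OF X(1)]]] by auto
  have XY: "X \<subseteq> Y"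
  proof
    fix x assume x: "x \<in> X"
    \<comment> \<open>Singletons are weakly compact, so absorbing \<open>{x}\<close> for every
      \<epsilon> brings \<open>x\<close> arbitrarily close to \<open>span K\<close>.\<close>
    have "\<exists>y\<in>span K. dist y x \<le> \<epsilon>" if \<epsilon>: "\<epsilon> > 0" for \<epsilon>
    proof -
      obtain n :: nat and k b where kb: "k \<in> K" "norm b \<le> 1" "x = real n *\<^sub>R k + \<epsilon> *\<^sub>R b"
        using absorb[OF \<epsilon> weakly_compact_singleton[OF X(1) x]] by auto
      have "dist (real n *\<^sub>R k) x \<le> \<epsilon>"
        using kb \<epsilon> by (simp add: dist_norm mult_left_le)
      then show ?thesis using kb(1) by (meson span_base span_scale)
    qed
    then show "x \<in> Y"
      unfolding Y_def closure_approachable_le by blast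
  qed
  have "\<exists>n::nat. L \<subseteq> {real n *\<^sub>R k + \<epsilon> *\<^sub>R b | k b. k \<in> K \<and> b \<in> Y \<inter> cball 0 1}"
    if \<epsilon>: "\<epsilon> > 0" and L: "weakly_compact X L" for \<epsilon> L
  proof -
    obtain n :: nat where n: "L \<subseteq> {real n *\<^sub>R k + \<epsilon> *\<^sub>R b | k b. k \<in> K \<and> b \<in> Z \<inter> cball 0 1}"
      using absorb[OF \<epsilon> L] by blast
    have "L \<subseteq> {real n *\<^sub>R k + \<epsilon> *\<^sub>R b | k b. k \<in> K \<and> b \<in> Y \<inter> cball 0 1}"
    proof
      fix x assume x: "x \<in> L"
      then obtain k b where kb: "k \<in> K" "b \<in> cball 0 1" "x = real n *\<^sub>R k + \<epsilon> *\<^sub>R b"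
        using n by auto
      \<comment> \<open>The error vector \<open>b\<close> is a multiple of the difference of
        \<open>x\<close> and \<open>real n *\<^sub>R k\<close>, both in \<open>Y\<close>; hence the
        ball of \<open>Z\<close> may be replaced by that of \<open>Y\<close>.\<close>
      have "x \<in> Y" using x weakly_compact_subset[OF X(1) L] XY by auto
      then have "(1/\<epsilon>) *\<^sub>R (x - real n *\<^sub>R k) \<in> Y"
        using kb(1) KY by (intro subspace_scale subspace_diff sY) auto
      then have "b \<in> Y" using \<epsilon> by (simp add: kb(3))
      then show "x \<in> {real n *\<^sub>R k + \<epsilon> *\<^sub>R b | k b. k \<in> K \<and> b \<in> Y \<inter> cball 0 1}"
        using kb by blast
    qed
    then show ?thesis ..
  qed
  from absorbing_imp_metrizable[OF Y weakly_compact_subspace[OF sZ sY YZ K(1) KY] K(2,3) Kne _ this]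
  show ?thesis using that Y XY unfolding Y_def by blast
qed

section \<open>From metrizability to strong weak compact generation\<close>

lemma mackey_nbhds_absorbed:
  fixes Z :: "'z::banach set" and U :: "nat \<Rightarrow> ('z \<Rightarrow> real) set"
  assumes Z: "banach_subspace Z" and U: "\<And>n. openin (mackey_ball_topology Z) (U n)"
    and U0: "\<And>n. restrict (\<lambda>x. 0) Z \<in> U n"
  obtains K where "weakly_compact Z K" "convex K" "symmetric_set K" "K \<noteq> {}"
    "\<And>n. \<exists>\<delta>>0. \<forall>g\<in>dual_ball Z. (\<forall>k\<in>K. \<bar>g k\<bar> \<le> \<delta>) \<longrightarrow> g \<in> U n"
proof -
  have sZ: "subspace Z" using Z unfolding banach_subspace_def by auto
  let ?\<S> = "{K. weakly_compact Z K \<and> convex K \<and> symmetric_set K}"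
  let ?z = "restrict (\<lambda>x. 0 :: real) Z"
  define Q where "Q = (\<lambda>n F e. finite F \<and> F \<subseteq> ?\<S> \<and> 0 < e \<and>
      (\<forall>g\<in>dual_ball Z. (\<forall>S\<in>F. \<forall>x\<in>S. \<bar>g x\<bar> < e) \<longrightarrow> g \<in> U n))"
  have "\<exists>F e. Q n F e" for n
  proof -
    obtain T where T: "openin (mackey_topology Z) T" "U n = T \<inter> dual_ball Z"
      using U[of n] unfolding mackey_ball_topology_def openin_subtopology by blast
    then have "?z \<in> T" using U0[of n] by auto
    then obtain F e where F: "finite F" "F \<subseteq> ?\<S>" "e > 0"
      "{g \<in> dual_space Z. \<forall>S\<in>F. \<forall>x\<in>S. \<bar>g x - ?z x\<bar> < e} \<subseteq> T"
      using T(1) unfolding mackey_topology_def openin_uniform_conv_topology by meson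
    have "g \<in> U n" if g: "g \<in> dual_ball Z" "\<forall>S\<in>F. \<forall>x\<in>S. \<bar>g x\<bar> < e" for g
    proof -
      have "?z x = 0" if "S \<in> F" "x \<in> S" for S x
        using that F(2) weakly_compact_subset[OF sZ] by auto
      then have "g \<in> {g \<in> dual_space Z. \<forall>S\<in>F. \<forall>x\<in>S. \<bar>g x - ?z x\<bar> < e}"
        using g unfolding dual_ball_def by auto
      then show ?thesis using F(4) g(1) T(2) by blast
    qed
    then show ?thesis using F(1-3) unfolding Q_def by (intro exI[of _ F] exI[of _ e]) auto
  qed
  then obtain F e where Q: "\<And>n. Q n (F n) (e n)" by metis
  have F: "finite (F n)" "F n \<subseteq> ?\<S>" and e: "e n > 0"
    and FU: "g \<in> dual_ball Z \<Longrightarrow> (\<And>S x. S \<in> F n \<Longrightarrow> x \<in> S \<Longrightarrow> \<bar>g x\<bar> < e n) \<Longrightarrow> g \<in> U n" for n g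
    subgoal using Q[of n] unfolding Q_def by (elim conjE)
    subgoal using Q[of n] unfolding Q_def by (elim conjE)
    subgoal using Q[of n] unfolding Q_def by (elim conjE)
    subgoal using Q[of n] unfolding Q_def by blast
    done
  \<comment> \<open>Empty sets are dropped because absorption needs nonempty ones;
    \<open>{0}\<close> guarantees that there is something to enumerate.\<close>
  define \<A> where "\<A> = insert {0} ((\<Union>n. F n) - {{}})"
  have ctbl: "countable \<A>"
    unfolding \<A>_def using F(1) by (intro countable_insert countable_Diff countable_UN) (auto intro: countable_finite)
  define C where "C = from_nat_into \<A>"
  have "\<A> \<noteq> {}" unfolding \<A>_def by auto
  then have C: "range C = \<A>"
    unfolding C_def using ctbl by (rule range_from_nat_into)
  have "weakly_compact Z S \<and> convex S \<and> symmetric_set S \<and> S \<noteq> {}" if "S \<in> \<A>" for S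
    using that F(2) weakly_compact_singleton[OF sZ subspace_0[OF sZ]]
    unfolding \<A>_def by (auto simp: symmetric_set_def)
  then have Cp: "weakly_compact Z (C i)" "convex (C i)" "symmetric_set (C i)" "C i \<noteq> {}" for i
    using C by auto
  obtain K where K: "weakly_compact Z K" "convex K" "symmetric_set K" "K \<noteq> {}"
    and CK: "\<And>i. \<exists>m>0. \<forall>x\<in>C i. \<exists>k\<in>K. x = m *\<^sub>R k"
    using weakly_compact_absorbing[of Z C, OF Z Cp] by blast
  have KZ: "K \<subseteq> Z" by (rule weakly_compact_subset[OF sZ K(1)])
  have "\<exists>\<delta>>0. \<forall>g\<in>dual_ball Z. (\<forall>k\<in>K. \<bar>g k\<bar> \<le> \<delta>) \<longrightarrow> g \<in> U n" for n
  proof -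
    have "\<exists>m>0. \<forall>x\<in>S. \<exists>k\<in>K. x = m *\<^sub>R k" if S: "S \<in> F n" for S
    proof (cases "S = {}")
      case True
      then show ?thesis by (intro exI[of _ 1]) auto
    next
      case False
      then have "S \<in> range C" unfolding C \<A>_def using S by auto
      then show ?thesis using CK by auto
    qed
    then obtain m where m: "\<And>S. S \<in> F n \<Longrightarrow> m S > 0"
      "\<And>S x. S \<in> F n \<Longrightarrow> x \<in> S \<Longrightarrow> \<exists>k\<in>K. x = m S *\<^sub>R k"
      by metis
    \<comment> \<open>\<open>M\<close> strictly exceeds every scaling factor, so the weak inequality
      on \<open>K\<close> becomes the strict one that the neighbourhood demands.\<close>
    define M where "M = 1 + sum m (F n)"
    have mM: "m S < M" if "S \<in> F n" for S
      using member_le_sum[OF that _ F(1), of m] m(1) unfolding M_def by (force simp: less_imp_le)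
    have M: "M > 0"
      unfolding M_def using sum_nonneg[of "F n" m] m(1) by (force simp: less_imp_le)
    show ?thesis
    proof (intro exI[of _ "e n / M"] conjI ballI impI)
      show "0 < e n / M" using e M by simp
      fix g assume g: "g \<in> dual_ball Z" and gK: "\<forall>k\<in>K. \<bar>g k\<bar> \<le> e n / M"
      show "g \<in> U n"
      proof (rule FU[OF g])
        fix S x assume S: "S \<in> F n" "x \<in> S"
        then obtain k where k: "k \<in> K" "x = m S *\<^sub>R k" using m(2) by blast
        have "g x = m S * g k"
          using g k KZ unfolding dual_ball_def dual_space_def by auto
        then have "\<bar>g x\<bar> = m S * \<bar>g k\<bar>" using m(1)[OF S(1)] by (simp add: abs_mult)
        also have "\<dots> \<le> m S * (e n / M)"
          using gK k(1) m(1)[OF S(1)] by (intro mult_left_mono) auto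
        also have "\<dots> < M * (e n / M)"
          using mM[OF S(1)] e M by (intro mult_strict_right_mono) auto
        finally show "\<bar>g x\<bar> < e n" using M by simp
      qed
    qed
  qed
  then show ?thesis using that[OF K] by blast
qed

text \<open>
  A quantitative bipolar theorem: if \<open>x\<close> had distance more than \<open>\<epsilon>\<close> from \<open>m K\<close>, a functional
  of norm at most 1 separating \<open>x\<close> from \<open>m K + \<epsilon> B\<close> would, once scaled to be at most \<open>\<delta>\<close> on
  \<open>K\<close>, be too large at \<open>x\<close>.
\<close>

lemma polar_absorb:
  fixes Z :: "'z::banach set"
  assumes Z: "subspace Z" and K: "K \<subseteq> Z" "convex K" "symmetric_set K" "K \<noteq> {}"
    and x: "x \<in> Z" and pos: "\<delta> > 0" "\<epsilon> > 0" and m: "m > 0" "\<epsilon> / \<delta> \<le> m"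
    and polar: "\<And>g. g \<in> dual_ball Z \<Longrightarrow> (\<And>k. k \<in> K \<Longrightarrow> \<bar>g k\<bar> \<le> \<delta>) \<Longrightarrow> \<bar>g x\<bar> < \<epsilon>/2"
  shows "\<exists>k\<in>K. norm (x - m *\<^sub>R k) \<le> \<epsilon>"
proof (rule ccontr)
  assume "\<not> ?thesis"
  then have far: "\<epsilon> \<le> norm (x + (- m) *\<^sub>R k)" if "k \<in> K" for k
    using that by force
  have "convex ((\<lambda>k. x + (- m) *\<^sub>R k) ` K)"
    using K(2) by (rule convex_affinity)
  then obtain F :: "'z \<Rightarrow>\<^sub>L real" where F1: "norm F \<le> 1"
    and F: "\<And>c. c \<in> (\<lambda>k. x + (- m) *\<^sub>R k) ` K \<Longrightarrow> \<epsilon> \<le> blinfun_apply F c"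
    using hahn_banach_norm[of "(\<lambda>k. x + (- m) *\<^sub>R k) ` K" \<epsilon>] far K(4) by blast
  have one: "blinfun_apply F k \<le> (blinfun_apply F x - \<epsilon>) / m" if "k \<in> K" for k
    using F[of "x + (- m) *\<^sub>R k"] that m(1)
    by (simp add: blinfun.add_right blinfun.diff_right blinfun.scaleR_right blinfun.minus_right field_simps)
  \<comment> \<open>Separation bounds \<open>F\<close> above by \<open>p\<close> on
    \<open>K\<close>, and symmetry makes this a bound on absolute values. At \<open>x\<close> the
    value is \<open>m * p + \<epsilon>\<close>.\<close>
  define p where "p = (blinfun_apply F x - \<epsilon>) / m"
  have abs: "\<bar>blinfun_apply F k\<bar> \<le> p" if "k \<in> K" for k
    using one[OF that] one[of "- k"] K(3) that unfolding symmetric_set_def p_def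
    by (simp add: blinfun.minus_right abs_le_iff)
  have p0: "0 \<le> p" using abs K(4) by fastforce
  have Fx: "blinfun_apply F x = m * p + \<epsilon>" unfolding p_def using m(1) by simp
  have scaled: "\<bar>t * blinfun_apply F x\<bar> < \<epsilon>/2" if t: "0 \<le> t" "t \<le> 1" "t * p \<le> \<delta>" for t
  proof -
    let ?g = "restrict (blinfun_apply (t *\<^sub>R F)) Z"
    have "norm (t *\<^sub>R F) \<le> 1 * 1"
      unfolding norm_scaleR using t F1 by (intro mult_mono) auto
    then have "?g \<in> dual_ball Z" using restrict_in_dual_ball[OF Z] by simp
    moreover have "\<bar>?g k\<bar> \<le> \<delta>" if "k \<in> K" for k
    proof -
      have "\<bar>?g k\<bar> = t * \<bar>blinfun_apply F k\<bar>"
        using that K(1) t(1) by (auto simp: blinfun.scaleR_left abs_mult)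
      also have "\<dots> \<le> t * p" using abs[OF that] t(1) by (rule mult_left_mono)
      finally show ?thesis using t(3) by simp
    qed
    ultimately have "\<bar>?g x\<bar> < \<epsilon>/2" by (rule polar)
    then show ?thesis using x by (simp add: blinfun.scaleR_left)
  qed
  show False
  \<comment> \<open>The largest admissible scale is taken: 1 if \<open>F\<close> is already small on
    \<open>K\<close>, otherwise \<open>\<delta> / p\<close>. In the second case the value at
    \<open>x\<close> is at least \<open>\<delta> * m\<close>, which is at least \<epsilon> by the
    choice of \<open>m\<close>.\<close>
  proof (cases "p \<le> \<delta>")
    case True
    have "0 \<le> m * p" using p0 m(1) by simp
    then show False using scaled[of 1] True Fx pos by simp
  next
    case False
    then have p: "\<delta> < p" "0 < p" using pos by auto
    have "\<bar>(\<delta> / p) * blinfun_apply F x\<bar> < \<epsilon>/2"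
      using pos p by (intro scaled) auto
    moreover have "(\<delta> / p) * blinfun_apply F x = \<delta> * m + (\<delta> / p) * \<epsilon>"
      unfolding Fx using p by (simp add: field_simps)
    moreover have "\<epsilon> \<le> \<delta> * m" using m(2) pos by (simp add: field_simps)
    moreover have "0 \<le> (\<delta> / p) * \<epsilon>" using pos p by simp
    ultimately show False using pos by linarith
  qed
qed

lemma metrizable_imp_swcg:
  fixes Z :: "'z::banach set"
  assumes Z: "banach_subspace Z" and X: "subspace X" "X \<subseteq> Z"
    and top: "topspace \<tau>\<^sub>d = dual_ball Z" and met: "metrizable_space \<tau>\<^sub>d"
    and fin: "finer_topology (mackey_ball_topology Z) \<tau>\<^sub>d" "finer_topology \<tau>\<^sub>d (sub_ball_topology X Z)"
  shows "swcg_wrt X Z"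
proof -
  have sZ: "subspace Z" using Z unfolding banach_subspace_def by auto
  obtain M d where Md: "Metric_space M d" and \<tau>: "\<tau>\<^sub>d = Metric_space.mtopology M d"
    using met unfolding metrizable_space_def by blast
  interpret Metric_space M d by (rule Md)
  have M: "M = dual_ball Z" using top unfolding \<tau> by simp
  let ?z = "restrict (\<lambda>x. 0 :: real) Z"
  have "restrict (blinfun_apply 0) Z \<in> dual_ball Z"
    by (rule restrict_in_dual_ball[OF sZ]) simp
  moreover have "blinfun_apply (0 :: 'z \<Rightarrow>\<^sub>L real) = (\<lambda>x. 0)" by auto
  ultimately have zB: "?z \<in> dual_ball Z" by metis
  define U where "U = (\<lambda>n::nat. mball ?z (1 / Suc n))"
  have "openin (mackey_ball_topology Z) (U n)" for n
    using fin(1) openin_mball unfolding finer_topology_def \<tau> U_def by blast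
  moreover have "?z \<in> U n" for n unfolding U_def using zB M by (subst centre_in_mball_iff) auto
  ultimately obtain K where K: "weakly_compact Z K" "convex K" "symmetric_set K" "K \<noteq> {}"
    and KU: "\<And>n. \<exists>\<delta>>0. \<forall>g\<in>dual_ball Z. (\<forall>k\<in>K. \<bar>g k\<bar> \<le> \<delta>) \<longrightarrow> g \<in> U n"
    using mackey_nbhds_absorbed[OF Z, of U] by blast
  have KZ: "K \<subseteq> Z" by (rule weakly_compact_subset[OF sZ K(1)])
  have "\<exists>n::nat. L \<subseteq> {real n *\<^sub>R k + \<epsilon> *\<^sub>R b | k b. k \<in> K \<and> b \<in> Z \<inter> cball 0 1}"
    if \<epsilon>: "\<epsilon> > 0" and L: "weakly_compact X L" for \<epsilon> L
  proof -
    have LZ: "L \<subseteq> Z" using weakly_compact_subset[OF X(1) L] X(2) by auto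
    \<comment> \<open>The threshold \<epsilon>/2 is the one required by
      \<open>polar_absorb\<close>.\<close>
    define V where "V = {f \<in> dual_ball Z. \<exists>\<eta><\<epsilon>/2. \<forall>x\<in>L. \<bar>f x - ?z x\<bar> \<le> \<eta>}"
    have "openin (sub_ball_topology X Z) V"
      unfolding sub_ball_topology_def V_def using L by (intro openin_uniform_conv_ball) auto
    then have "openin mtopology V"
      using fin(2) unfolding finer_topology_def \<tau> by blast
    moreover have "?z \<in> V"
      unfolding V_def using zB \<epsilon> by (auto intro!: exI[of _ 0])
    ultimately obtain r where r: "r > 0" "mball ?z r \<subseteq> V"
      unfolding openin_mtopology by blast
    obtain n :: nat where "1 / Suc n < r"
      using r(1) nat_approx_posE by blast
    then have UV: "U n \<subseteq> V"
      using r(2) mball_subset_concentric[of "1 / Suc n" r ?z] unfolding U_def by auto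
    obtain \<delta> where \<delta>: "\<delta> > 0" "\<And>g. g \<in> dual_ball Z \<Longrightarrow> (\<And>k. k \<in> K \<Longrightarrow> \<bar>g k\<bar> \<le> \<delta>) \<Longrightarrow> g \<in> U n"
      using KU[of n] by blast
    \<comment> \<open>The factor depends on \<epsilon> and \<delta> but not on the point of
      \<open>L\<close>, so one multiple of \<open>K\<close> serves all of \<open>L\<close>;
      \<open>Suc\<close> makes it positive.\<close>
    define m where "m = Suc (nat \<lceil>\<epsilon> / \<delta>\<rceil>)"
    have m: "real m > 0" "\<epsilon> / \<delta> \<le> real m"
      using real_nat_ceiling_ge[of "\<epsilon> / \<delta>"] unfolding m_def by auto
    have "x \<in> {real m *\<^sub>R k + \<epsilon> *\<^sub>R b | k b. k \<in> K \<and> b \<in> Z \<inter> cball 0 1}" if x: "x \<in> L" for x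
    proof -
      have "\<bar>g x\<bar> < \<epsilon>/2" if g: "g \<in> dual_ball Z" "\<And>k. k \<in> K \<Longrightarrow> \<bar>g k\<bar> \<le> \<delta>" for g
      proof -
        have "g \<in> V" using \<delta>(2)[OF g] UV by blast
        then obtain \<eta> where "\<eta> < \<epsilon>/2" "\<bar>g x - ?z x\<bar> \<le> \<eta>" unfolding V_def using x by auto
        moreover have "?z x = 0" using x LZ by auto
        ultimately show ?thesis by simp
      qed
      then obtain k where k: "k \<in> K" "norm (x - real m *\<^sub>R k) \<le> \<epsilon>"
        using polar_absorb[OF sZ KZ K(2-4), of x \<delta> \<epsilon> "real m"] x LZ \<delta>(1) \<epsilon> m by blast
      define b where "b = (1/\<epsilon>) *\<^sub>R (x - real m *\<^sub>R k)"
      have "b \<in> Z"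
        unfolding b_def using x LZ k(1) KZ by (intro subspace_scale subspace_diff sZ) auto
      moreover have "norm b \<le> 1" unfolding b_def using k(2) \<epsilon> by simp
      moreover have "x = real m *\<^sub>R k + \<epsilon> *\<^sub>R b" unfolding b_def using \<epsilon> by simp
      ultimately show ?thesis using k(1) by auto
    qed
    then show ?thesis by blast
  qed
  then show ?thesis
    unfolding swcg_wrt_def using K by blast
qed

theorem theorem2p10:
  shows "(\<exists>(Z :: 'z::banach set) (j :: 'x::banach \<Rightarrow> 'z).
            contained_via j Z \<and> swcg_wrt (range j) Z)
     \<longleftrightarrow>
         (\<exists>(Z :: 'z set) (j :: 'x \<Rightarrow> 'z).
            contained_via j Z \<and>
            (\<exists>\<tau>\<^sub>d. topspace \<tau>\<^sub>d = dual_ball Z \<and> metrizable_space \<tau>\<^sub>d \<and>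
                  finer_topology (mackey_ball_topology Z) \<tau>\<^sub>d \<and>
                  finer_topology \<tau>\<^sub>d (sub_ball_topology (range j) Z)))"
  (is "?L \<longleftrightarrow> ?R")
proof
  assume ?L
  then obtain Z :: "'z set" and j :: "'x \<Rightarrow> 'z"
    where j: "contained_via j Z" and sw: "swcg_wrt (range j) Z" by blast
  have Z: "banach_subspace Z" "range j \<subseteq> Z" and sX: "subspace (range j)"
    using j linear_subspace_image[of j UNIV] unfolding contained_via_def by auto
  obtain Y \<tau>\<^sub>d where Y: "banach_subspace Y" "range j \<subseteq> Y"
    and \<tau>: "topspace \<tau>\<^sub>d = dual_ball Y" "metrizable_space \<tau>\<^sub>d"
      "finer_topology (mackey_ball_topology Y) \<tau>\<^sub>d" "finer_topology \<tau>\<^sub>d (sub_ball_topology (range j) Y)"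
    using swcg_imp_metrizable[OF Z(1) sX Z(2) sw] by blast
  have "contained_via j Y" using j Y unfolding contained_via_def by blast
  then show ?R using \<tau> by blast
next
  assume ?R
  then obtain Z :: "'z set" and j :: "'x \<Rightarrow> 'z" and \<tau>\<^sub>d
    where j: "contained_via j Z"
      and \<tau>: "topspace \<tau>\<^sub>d = dual_ball Z" "metrizable_space \<tau>\<^sub>d"
        "finer_topology (mackey_ball_topology Z) \<tau>\<^sub>d" "finer_topology \<tau>\<^sub>d (sub_ball_topology (range j) Z)"
    by blast
  have Z: "banach_subspace Z" "range j \<subseteq> Z" and sX: "subspace (range j)"
    using j linear_subspace_image[of j UNIV] unfolding contained_via_def by auto
  show ?L using j metrizable_imp_swcg[OF Z(1) sX Z(2) \<tau>] by blast
qed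


end
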